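(* Let $(X,Y)$ be a norming dual pair, and let $\mathbf{T}=(T(t))_{t\ge0}$ and $\mathbf{S}=(S(t))_{t\ge0}$ be integrable semigroups on $(X,Y)$ of type $(M_T,\omega_T)$ and $(M_S,\omega_S)$ respectively, with Laplace transforms $R_{\mathbf{T}}$ and $R_{\mathbf{S}}$. Suppose that, for some real $\lambda>\max\{\omega_T,\omega_S\}$ and some multivalued operator $\mathcal{A}$, we have $R_{\mathbf{T}}(\lambda)=(\lambda-\mathcal{A})^{-1}=R_{\mathbf{S}}(\lambda)$. Then $T(t)=S(t)$ for all $t\ge0$, provided one of the following conditions is satisfied: (i) $D(\mathcal{A})$ is $\sigma(X,Y)$-dense in $X$; (ii) $(X,Y)$ is countably separated.
   Context: A norming dual pair $(X,Y)$ consists of nontrivial (complex) Banach spaces $X,Y$ and a duality pairing (bilinear form) $\langle\cdot,\cdot\rangle:X\times Y\to\mathbb{C}$ such that $\|x\|_X=\sup\{|\langle x,y\rangle|: y\in Y,\|y\|_Y\le1\}$ for all $x\in X$ and $\|y\|_Y=\sup\{|\langle x,y\rangle|: x\in X,\|x\|_X\le1\}$ for all $y\in Y$. Write $\sigma=\sigma(X,Y)$ for the weak topology on $X$ induced by $Y$, and $L(X,\sigma)$ for the algebra of $\sigma$-continuous linear operators on $X$ (these are automatically norm bounded). A semigroup on $(X,Y)$ is a family $\mathbf{T}=(T(t))_{t\ge0}\subset L(X,\sigma)$ with $T(t+s)=T(t)T(s)$ for all $t,s\ge0$ and $T(0)=\mathrm{id}_X$. It is of type $(M,\omega)$, where $M\ge1$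 and $\omega\in\mathbb{R}$, if $\|T(t)\|\le Me^{\omega t}$ for all $t\ge0$. A semigroup of type $(M,\omega)$ is called integrable if $t\mapsto\langle T(t)x,y\rangle$ is measurable for all $x\in X,y\in Y$ and there exist a complex number $\lambda_0$ with $\mathrm{Re}\,\lambda_0>\omega$ and an operator $R_0\in L(X,\sigma)$ such that $\langle R_0x,y\rangle=\int_0^\infty e^{-\lambda_0t}\langle T(t)x,y\rangle\,dt$ for all $x\in X,y\in Y$. In that case, for every $\lambda$ with $\mathrm{Re}\,\lambda>\omega$ there is a unique $R(\lambda)\in L(X,\sigma)$ with $\langle R(\lambda)x,y\rangle=\int_0^\infty e^{-\lambda t}\langle T(t)x,y\rangle\,dt$ for all $x\in X,y\in Y$; the family $(R(\lambda))_{\mathrm{Re}\,\lambda>\omega}$ is called the Laplace transform of $\mathbf{T}$ (denoted $R_{\mathbf{T}}$). A multivalued operator $\mathcal{A}$ on $X$ is a linear subspace of $X\times X$; $z\in\mathcal{A}x$ means $(x,z)\in\mathcal{A}$, $D(\mathcal{A})=\{x:\exists z,\ (x,z)\in\mathcal{A}\}$, and $(\lambda-\mathcal{A})^{-1}=\{(\lambda x-z,x):(x,z)\in\mathcal{A}\}$. Thus $R(\lambda)=(\lambda-\mathcal{A})^{-1}$ means: $(x,z)\in\mathcal{A}$ iff $x=R(\lambda)(\lambda x-z)$; in particular $D(\mathcal{A})=\mathrm{rg}\,R(\lambda)$. $(X,Y)$ is countably separated if there is a countable subset of $X$ separating points in $Y$ and a countable subset of $Y$ separating points in $X$, where a set $W$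 of functionals separates points in a space $V$ if for every $v\in V\setminus\{0\}$ there is $w\in W$ with $\langle v,w\rangle\ne0$. *)

theory Defs
  imports "HOL-Analysis.Analysis"
begin

section \<open>Complex Banach spaces\<close>

text \<open>The complex scalar multiplication extends the real one of class \<open>banach\<close>, so norm,
  metric and topology are those of the library.\<close>

class complex_banach = banach +
  fixes scaleC :: "complex \<Rightarrow> 'a \<Rightarrow> 'a"  (infixr \<open>*\<^sub>C\<close> 75)
  assumes scaleC_add_right: "c *\<^sub>C (x + y) = c *\<^sub>C x + c *\<^sub>C y"
    and scaleC_add_left: "(c + d) *\<^sub>C x = c *\<^sub>C x + d *\<^sub>C x"
    and scaleC_scaleC: "c *\<^sub>C d *\<^sub>C x = (c * d) *\<^sub>C x"
    and scaleC_of_real: "complex_of_real r *\<^sub>C x = r *\<^sub>R x"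
    and norm_scaleC: "norm (c *\<^sub>C x) = cmod c * norm x"

global_interpretation complex_vector: vector_space "scaleC :: complex \<Rightarrow> 'a \<Rightarrow> 'a::complex_banach"
proof
  fix x :: 'a
  show "1 *\<^sub>C x = x"
    using scaleC_of_real[of 1 x] by simp
qed (rule scaleC_add_right scaleC_add_left scaleC_scaleC)+

instantiation complex :: complex_banach
begin

definition scaleC_complex :: "complex \<Rightarrow> complex \<Rightarrow> complex"
  where "scaleC_complex c z = c * z"

instance
  by standard (simp_all add: scaleC_complex_def algebra_simps scaleR_conv_of_real norm_mult)

end

instantiation prod :: (complex_banach, complex_banach) complex_banach
begin

definition scaleC_prod :: "complex \<Rightarrow> 'a \<times> 'b \<Rightarrow> 'a \<times> 'b"
  where "scaleC_prod c p = (c *\<^sub>C fst p, c *\<^sub>C snd p)"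

instance
proof
  fix c :: complex and p :: "'a \<times> 'b"
  have "(cmod c * norm (fst p))\<^sup>2 + (cmod c * norm (snd p))\<^sup>2
      = (cmod c)\<^sup>2 * ((norm (fst p))\<^sup>2 + (norm (snd p))\<^sup>2)"
    by (simp add: power_mult_distrib distrib_left)
  then show "norm (c *\<^sub>C p) = cmod c * norm p"
    by (simp add: scaleC_prod_def norm_prod_def norm_scaleC real_sqrt_mult)
qed (simp_all add: scaleC_prod_def scaleC_add_right scaleC_add_left scaleC_scaleC
      scaleC_of_real scaleR_prod_def)

end

abbreviation clinear :: "('a::complex_banach \<Rightarrow> 'b::complex_banach) \<Rightarrow> bool"
  where "clinear \<equiv> Vector_Spaces.linear scaleC scaleC"

abbreviation csubspace :: "'a::complex_banach set \<Rightarrow> bool"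
  where "csubspace \<equiv> complex_vector.subspace"


section \<open>Norming dual pairs\<close>

text \<open>The suprema are taken in the extended reals, so that their finiteness is part of the
  requirement.\<close>

locale norming_dual_pair =
  fixes pairing :: "'x::complex_banach \<Rightarrow> 'y::complex_banach \<Rightarrow> complex"
  assumes nontrivial_left: "\<exists>x::'x. x \<noteq> 0"
    and nontrivial_right: "\<exists>y::'y. y \<noteq> 0"
    and clinear_left: "clinear (\<lambda>x. pairing x y)"
    and clinear_right: "clinear (\<lambda>y. pairing x y)"
    and norming_left: "ereal (norm x) = (SUP y\<in>{y. norm y \<le> 1}. ereal (cmod (pairing x y)))"
    and norming_right: "ereal (norm y) = (SUP x\<in>{x. norm x \<le> 1}. ereal (cmod (pairing x y)))"

definition weak_topology ::
    "('x::complex_banach \<Rightarrow> 'y::complex_banach \<Rightarrow> complex) \<Rightarrow> 'x topology"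
  where "weak_topology pairing =
    topology_generated_by {{x. pairing x y \<in> U} | y U. open U}"

definition weakly_continuous_operators ::
    "('x::complex_banach \<Rightarrow> 'y::complex_banach \<Rightarrow> complex) \<Rightarrow> ('x \<Rightarrow> 'x) set"
  where "weakly_continuous_operators pairing =
    {T. clinear T \<and> continuous_map (weak_topology pairing) (weak_topology pairing) T}"

definition countably_separated ::
    "('x::complex_banach \<Rightarrow> 'y::complex_banach \<Rightarrow> complex) \<Rightarrow> bool"
  where "countably_separated pairing \<longleftrightarrow>
    (\<exists>V. countable V \<and> (\<forall>y. y \<noteq> 0 \<longrightarrow> (\<exists>x\<in>V. pairing x y \<noteq> 0))) \<and>
    (\<exists>W. countable W \<and> (\<forall>x. x \<noteq> 0 \<longrightarrow> (\<exists>y\<in>W. pairing x y \<noteq> 0)))"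


section \<open>Integrable semigroups and their Laplace transforms\<close>

text \<open>A semigroup is given as a function on all of \<open>real\<close>, of which only the values at
  \<open>t \<ge> 0\<close> matter.\<close>

definition semigroup_on ::
    "('x::complex_banach \<Rightarrow> 'y::complex_banach \<Rightarrow> complex) \<Rightarrow> (real \<Rightarrow> 'x \<Rightarrow> 'x) \<Rightarrow> bool"
  where "semigroup_on pairing T \<longleftrightarrow>
    (\<forall>t\<ge>0. T t \<in> weakly_continuous_operators pairing) \<and>
    (\<forall>t\<ge>0. \<forall>s\<ge>0. T (t + s) = T t \<circ> T s) \<and>
    T 0 = id"

text \<open>The operator norm bound is written pointwise: \<open>onorm\<close> is a supremum in the reals and
  would be unspecified on an unbounded map.\<close>

definition semigroup_of_type ::
    "('x::complex_banach \<Rightarrow> 'y::complex_banach \<Rightarrow> complex) \<Rightarrow> real \<Rightarrow> real \<Rightarrow>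
      (real \<Rightarrow> 'x \<Rightarrow> 'x) \<Rightarrow> bool"
  where "semigroup_of_type pairing M \<omega> T \<longleftrightarrow>
    semigroup_on pairing T \<and> M \<ge> 1 \<and>
    (\<forall>t\<ge>0. \<forall>x. norm (T t x) \<le> M * exp (\<omega> * t) * norm x)"

definition laplace_operator ::
    "('x::complex_banach \<Rightarrow> 'y::complex_banach \<Rightarrow> complex) \<Rightarrow> (real \<Rightarrow> 'x \<Rightarrow> 'x) \<Rightarrow>
      complex \<Rightarrow> ('x \<Rightarrow> 'x) \<Rightarrow> bool"
  where "laplace_operator pairing T \<mu> R \<longleftrightarrow>
    R \<in> weakly_continuous_operators pairing \<and>
    (\<forall>x y. pairing (R x) y =
      (LINT t|lebesgue_on {0..}. exp (- \<mu> * complex_of_real t) * pairing (T t x) y))"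

definition integrable_semigroup ::
    "('x::complex_banach \<Rightarrow> 'y::complex_banach \<Rightarrow> complex) \<Rightarrow> real \<Rightarrow> real \<Rightarrow>
      (real \<Rightarrow> 'x \<Rightarrow> 'x) \<Rightarrow> bool"
  where "integrable_semigroup pairing M \<omega> T \<longleftrightarrow>
    semigroup_of_type pairing M \<omega> T \<and>
    (\<forall>x y. (\<lambda>t. pairing (T t x) y) \<in> borel_measurable (lebesgue_on {0..})) \<and>
    (\<exists>\<mu>\<^sub>0 R\<^sub>0. Re \<mu>\<^sub>0 > \<omega> \<and> laplace_operator pairing T \<mu>\<^sub>0 R\<^sub>0)"

text \<open>For an integrable semigroup of type \<open>(M, \<omega>)\<close> on a norming dual pair, the operator
  described here exists and is unique for every \<open>\<mu>\<close> with \<open>Re \<mu> > \<omega>\<close>; for other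
  \<open>\<mu>\<close> the value is not meaningful.\<close>

definition laplace_transform ::
    "('x::complex_banach \<Rightarrow> 'y::complex_banach \<Rightarrow> complex) \<Rightarrow> (real \<Rightarrow> 'x \<Rightarrow> 'x) \<Rightarrow>
      complex \<Rightarrow> 'x \<Rightarrow> 'x"
  where "laplace_transform pairing T \<mu> = (THE R. laplace_operator pairing T \<mu> R)"


section \<open>Multivalued operators\<close>

text \<open>A multivalued operator is a set \<open>A\<close> of pairs with \<open>csubspace A\<close>; its domain is
  \<open>Domain A\<close>. A single-valued operator is identified with its graph.\<close>

definition graph_of :: "('a \<Rightarrow> 'b) \<Rightarrow> ('a \<times> 'b) set"
  where "graph_of R = {(u, R u) | u. True}"

definition resolvent :: "complex \<Rightarrow> ('x::complex_banach \<times> 'x) set \<Rightarrow> ('x \<times> 'x) set"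
  where "resolvent \<mu> A = {(\<mu> *\<^sub>C x - z, x) | x z. (x, z) \<in> A}"

end

theory Submission
  imports Defs
begin

text \<open>The resolvent identity determines \<open>R(z')\<close> from \<open>R(z)\<close> by a Neumann series when \<open>z'\<close> is
  close to \<open>z\<close>, so the two Laplace transforms, being equal at \<open>\<mu>\<close>, exist and agree on a common
  half plane. Hence \<open>\<langle>T(r)x, y\<rangle>\<close> and \<open>\<langle>S(r)x, y\<rangle>\<close> have equal Laplace transforms and agree
  almost everywhere. Since \<open>\<langle>T(t)R(\<mu>)x, y\<rangle>\<close> is an integral of \<open>e\<^bsup>-\<mu>r\<^esup>\<langle>T(r)x, y\<rangle>\<close> over
  \<open>r \<ge> t\<close>, the semigroups agree on the range of \<open>R(\<mu>)\<close> for every \<open>t\<close>; weak density of this range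
  gives (i). Under (ii) the null sets for countably many \<open>x\<close> and \<open>y\<close> combine into one null set off
  which \<open>T(t) = S(t)\<close>, and every \<open>t > 0\<close> is a sum of two times off that set.\<close>

section \<open>Laplace transforms of exponentially bounded functions\<close>

definition exp_bounded :: "real \<Rightarrow> (real \<Rightarrow> complex) \<Rightarrow> bool"
  where "exp_bounded \<omega> f \<longleftrightarrow> f \<in> borel_measurable (lebesgue_on {0..}) \<and>
    (\<exists>C\<ge>0. \<forall>t\<ge>0. cmod (f t) \<le> C * exp (\<omega> * t))"

text \<open>A Bochner integral, so its value is 0 where the integrand is not integrable. For
  \<open>exp_bounded \<omega> f\<close> the integral converges absolutely on
  \<open>Re z > \<omega>\<close>.\<close>

definition laplace :: "(real \<Rightarrow> complex) \<Rightarrow> complex \<Rightarrow> complex"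
  where "laplace f z = (LINT t|lebesgue_on {0..}. exp (- z * complex_of_real t) * f t)"

section \<open>Integration and convergence on the half line\<close>

lemma sigma_finite_lebesgue_on:
  fixes A :: "'a::euclidean_space set"
  assumes "A \<in> sets lebesgue"
  shows "sigma_finite_measure (lebesgue_on A)"
proof (rule sigma_finite_measure_restrict_space)
  obtain B :: "'a set set" where B: "countable B" "B \<subseteq> sets lborel" "\<Union>B = space lborel"
    "\<forall>a\<in>B. emeasure lborel a \<noteq> \<infinity>"
    using lborel.sigma_finite_countable by blast
  \<comment> \<open>Borel sets keep their measure in the completion, so the finite-measure cover for
    \<open>lborel\<close> also serves \<open>lebesgue\<close>.\<close>
  have "emeasure lebesgue a \<noteq> \<infinity>" if "a \<in> B" for a
    using B that emeasure_completion[of a lborel] by auto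
  moreover have "B \<subseteq> sets lebesgue"
    using B(2) by (blast intro: sets_completionI_sets)
  ultimately show "sigma_finite_measure (lebesgue :: 'a measure)"
    using B(1,3) by (intro sigma_finite_measure.intro exI[of _ B]) simp
qed (use assms in auto)

interpretation halfline: sigma_finite_measure "lebesgue_on {0::real..}"
  by (rule sigma_finite_lebesgue_on) simp

lemma integral_lebesgue_on_eq_indicator:
  fixes f :: "real \<Rightarrow> 'a::{banach, second_countable_topology}"
  assumes "A \<in> sets lebesgue" "B \<in> sets lebesgue" "B \<subseteq> A"
  shows "(LINT t|lebesgue_on A. indicator B t *\<^sub>R f t) = (LINT t|lebesgue_on B. f t)"
proof -
  have "(\<lambda>t. indicator A t *\<^sub>R indicator B t *\<^sub>R f t) = (\<lambda>t. indicator B t *\<^sub>R f t)"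
    using assms(3) by (auto simp: fun_eq_iff indicator_def)
  then show ?thesis
    using assms by (simp add: integral_restrict_space)
qed

lemma integrable_exp_halfline:
  assumes "a > 0"
  shows "integrable (lebesgue_on {0..}) (\<lambda>t. exp (- a * t) :: real)"
proof -
  have "(\<lambda>t. exp (- a * t) :: real) absolutely_integrable_on {0..}"
    using integrable_on_exp_minus_to_infinity[OF assms, of 0]
    by (intro nonnegative_absolutely_integrable_1) auto
  then show ?thesis
    by (simp add: set_integrable_def integrable_restrict_space)
qed

lemma measurable_lebesgue_on [measurable (raw)]:
  "f \<in> borel_measurable borel \<Longrightarrow> f \<in> borel_measurable (lebesgue_on A)"
  by (simp add: borel_measurable_if_D measurable_completion measurable_restrict_space1)

lemma cmod_laplace_integrand_le:
  assumes "cmod x \<le> C * exp (\<omega> * t)"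
  shows "cmod (exp (- z * complex_of_real t) * x) \<le> C * exp (- (Re z - \<omega>) * t)"
proof -
  have "cmod (exp (- z * complex_of_real t) * x) = exp (- Re z * t) * cmod x"
    by (simp add: norm_mult)
  also have "\<dots> \<le> exp (- Re z * t) * (C * exp (\<omega> * t))"
    using assms by (intro mult_left_mono) auto
  also have "\<dots> = C * exp (- (Re z - \<omega>) * t)"
    by (simp add: algebra_simps flip: exp_add)
  finally show ?thesis .
qed

text \<open>The integrand is dominated by \<open>C * exp (- (Re z - \<omega>) * t)\<close>, whose
  rate is strictly negative.\<close>

lemma exp_bounded_integrable:
  assumes f: "exp_bounded \<omega> f" and z: "Re z > \<omega>"
  shows "integrable (lebesgue_on {0..}) (\<lambda>t. exp (- z * complex_of_real t) * f t)"
proof -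
  obtain C where C: "\<And>t. t \<ge> 0 \<Longrightarrow> cmod (f t) \<le> C * exp (\<omega> * t)"
    and [measurable]: "f \<in> borel_measurable (lebesgue_on {0..})"
    using f by (auto simp: exp_bounded_def)
  show ?thesis
  proof (rule Bochner_Integration.integrable_bound)
    show "integrable (lebesgue_on {0..}) (\<lambda>t. C * exp (- (Re z - \<omega>) * t))"
      using integrable_exp_halfline[of "Re z - \<omega>"] z by simp
    show "(\<lambda>t. exp (- z * complex_of_real t) * f t) \<in> borel_measurable (lebesgue_on {0..})"
      by measurable
    show "AE t in lebesgue_on {0..}. norm (exp (- z * complex_of_real t) * f t)
        \<le> norm (C * exp (- (Re z - \<omega>) * t))"
    proof (rule AE_I2)
      fix t :: real assume "t \<in> space (lebesgue_on {0..})"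
      then have "t \<ge> 0" by simp
      then show "norm (exp (- z * complex_of_real t) * f t) \<le> norm (C * exp (- (Re z - \<omega>) * t))"
        using cmod_laplace_integrand_le[OF C] order.trans[OF _ abs_ge_self] real_norm_def by metis
    qed
  qed
qed

lemma laplace_diff:
  assumes "exp_bounded \<omega> f" "exp_bounded \<omega> g" "Re z > \<omega>"
  shows "laplace (\<lambda>t. f t - g t) z = laplace f z - laplace g z"
  using exp_bounded_integrable[OF assms(1,3)] exp_bounded_integrable[OF assms(2,3)]
  by (simp add: laplace_def algebra_simps)

lemma exp_bounded_diff:
  assumes "exp_bounded \<omega> f" "exp_bounded \<omega> g"
  shows "exp_bounded \<omega> (\<lambda>t. f t - g t)"
proof -
  obtain C D where C: "C \<ge> 0" "\<And>t. t \<ge> 0 \<Longrightarrow> cmod (f t) \<le> C * exp (\<omega> * t)"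
    and D: "D \<ge> 0" "\<And>t. t \<ge> 0 \<Longrightarrow> cmod (g t) \<le> D * exp (\<omega> * t)"
    using assms unfolding exp_bounded_def by auto
  have "cmod (f t - g t) \<le> (C + D) * exp (\<omega> * t)" if "t \<ge> 0" for t
    using C(2)[OF that] D(2)[OF that] norm_triangle_ineq4[of "f t" "g t"]
    by (simp add: algebra_simps)
  then show ?thesis
    using assms C(1) D(1) unfolding exp_bounded_def
    by (intro conjI borel_measurable_diff exI[of _ "C + D"]) auto
qed

text \<open>Integrating the dominating exponential gives the bound. Applied to the orbits of a
  semigroup it becomes the norm bound on its Laplace transform that controls the radius of the
  Neumann series.\<close>

lemma cmod_laplace_le:
  assumes f: "f \<in> borel_measurable (lebesgue_on {0..})"
    and C: "\<And>t. t \<ge> 0 \<Longrightarrow> cmod (f t) \<le> C * exp (\<omega> * t)" and z: "Re z > \<omega>"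
  shows "cmod (laplace f z) \<le> C / (Re z - \<omega>)"
proof -
  have C0: "C \<ge> 0"
    using order.trans[OF norm_ge_zero C[of 0]] by simp
  then have int: "integrable (lebesgue_on {0..}) (\<lambda>t. exp (- z * complex_of_real t) * f t)"
    using f C z by (intro exp_bounded_integrable[of \<omega>]) (auto simp: exp_bounded_def)
  have "cmod (laplace f z) \<le> (LINT t|lebesgue_on {0..}. norm (exp (- z * complex_of_real t) * f t))"
    unfolding laplace_def by (rule integral_norm_bound)
  also have "\<dots> \<le> (LINT t|lebesgue_on {0..}. C * exp (- (Re z - \<omega>) * t))"
  proof (rule integral_mono)
    fix t :: real assume "t \<in> space (lebesgue_on {0..})"
    then have "t \<ge> 0" by simp
    then show "norm (exp (- z * complex_of_real t) * f t) \<le> C * exp (- (Re z - \<omega>) * t)"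
      by (intro cmod_laplace_integrand_le C)
  qed (use int integrable_exp_halfline[of "Re z - \<omega>"] z in auto)
  also have "\<dots> = C * integral {0..} (\<lambda>t. exp (- (Re z - \<omega>) * t))"
    using integrable_exp_halfline[of "Re z - \<omega>"] z by (simp add: lebesgue_integral_eq_integral)
  also have "\<dots> = C / (Re z - \<omega>)"
    using has_integral_exp_minus_to_infinity[of "Re z - \<omega>" 0] z by (simp add: integral_unique)
  finally show ?thesis .
qed

text \<open>Substitution \<open>r = s + t\<close>. It identifies the transform of a translate with a
  tail integral, which is how the value of \<open>T s\<close> on the range of the resolvent becomes
  visible at every single time \<open>s\<close>.\<close>

lemma laplace_shift:
  assumes "s \<ge> 0"
  shows "laplace (\<lambda>t. f (s + t)) z
    = exp (z * complex_of_real s) * (LINT r|lebesgue_on {s..}. exp (- z * complex_of_real r) * f r)"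
proof -
  have "(LINT r|lebesgue_on {s..}. exp (- z * complex_of_real r) * f r)
      = (\<integral>r. indicator {s..} r *\<^sub>R (exp (- z * complex_of_real r) * f r) \<partial>lebesgue)"
    by (simp add: integral_restrict_space)
  also have "\<dots> = (\<integral>t. indicator {0..} t *\<^sub>R (exp (- z * complex_of_real s)
      * (exp (- z * complex_of_real t) * f (s + t))) \<partial>lebesgue)"
    by (subst lebesgue_integral_real_affine[where c = 1 and t = s])
      (auto simp: distrib_left exp_add exp_diff exp_minus divide_inverse split: split_indicator
        intro!: Bochner_Integration.integral_cong)
  also have "\<dots> = exp (- z * complex_of_real s) * laplace (\<lambda>t. f (s + t)) z"
    by (simp add: laplace_def integral_restrict_space mult.left_commute flip: integral_mult_right_zero)
  finally show ?thesis
    by (simp add: mult_exp_exp flip: mult.assoc)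
qed

lemma integral_exp_lebesgue_on:
  assumes "r \<ge> 0" "a \<noteq> 0"
  shows "(LINT s|lebesgue_on {0..r}. exp (a * complex_of_real s)) = (exp (a * of_real r) - 1) / a"
proof -
  have "continuous_on {0..r} (\<lambda>s. exp (a * complex_of_real s))"
    by (intro continuous_intros)
  then have "integrable (lebesgue_on {0..r}) (\<lambda>s. exp (a * complex_of_real s))"
    by (rule continuous_imp_integrable_real)
  then show ?thesis
    using integral_exp[OF assms] by (simp add: lebesgue_integral_eq_integral)
qed

text \<open>On \<open>0 \<le> s \<le> r\<close> the integrand is dominated by the product
  \<open>C e\<^bsup>-mr/2\<^esup> e\<^bsup>-ms/2\<^esup>\<close> with \<open>m = min (Re z) (Re w) - \<omega>\<close>, which permits Fubini.\<close>

lemma laplace_laplace_shift: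
  assumes f: "exp_bounded \<omega> f" and z: "Re z > \<omega>" and w: "Re w > \<omega>"
  shows "(z - w) * laplace (\<lambda>s. laplace (\<lambda>t. f (s + t)) w) z = laplace f w - laplace f z"
proof (cases "z = w")
  case False
  obtain C where C: "C \<ge> 0" "\<And>t. t \<ge> 0 \<Longrightarrow> cmod (f t) \<le> C * exp (\<omega> * t)"
    and [measurable]: "f \<in> borel_measurable (lebesgue_on {0..})"
    using f by (auto simp: exp_bounded_def)
  define M where "M = lebesgue_on {0::real..}"
  have [measurable]: "f \<in> borel_measurable M"
    "(\<lambda>t. t) \<in> borel_measurable M"
    by (simp_all add: M_def measurable_lebesgue_on)
  \<comment> \<open>The double integrand on the triangle \<open>0 \<le> s \<le> r\<close>.
    Integrating in \<open>r\<close> first yields the shifted transform at \<open>w\<close>;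
    integrating in \<open>s\<close> first leaves \<open>exp ((w - z) * s)\<close> on
    \<open>{0..r}\<close>, hence a difference quotient of transforms.\<close>
  define g :: "real \<Rightarrow> real \<Rightarrow> complex" where
    "g s r = indicator {0..r} s *\<^sub>R (exp ((w - z) * complex_of_real s) * (exp (- w * complex_of_real r) * f r))" for s r
  define m where "m = min (Re z) (Re w) - \<omega>"
  have m: "m > 0" using z w by (simp add: m_def)
  have gle: "norm (g s r) \<le> C * exp (- (m/2) * s) * exp (- (m/2) * r)" if "s \<ge> 0" "r \<ge> 0" for s r
  proof (cases "s \<le> r")
    case True
    \<comment> \<open>The left side is
      \<open>- (Re w - \<omega>) * (r - s) - (Re z - \<omega>) * s\<close>, hence at most
      \<open>- m * r\<close>; since \<open>s \<le> r\<close>, half of this decay can be traded for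
      decay in \<open>s\<close>.\<close>
    have le: "Re w * s - Re z * s - Re w * r + \<omega> * r \<le> - (m/2) * s - (m/2) * r"
    proof -
      have "m * (r - s) \<le> (Re w - \<omega>) * (r - s)" "m * s \<le> (Re z - \<omega>) * s" "m * s \<le> m * r"
        using True that m by (auto intro!: mult_right_mono mult_left_mono simp: m_def)
      then show ?thesis by (simp add: algebra_simps)
    qed
    have "norm (g s r) = exp (Re w * s - Re z * s) * exp (- Re w * r) * cmod (f r)"
      using True that by (simp add: g_def norm_mult algebra_simps)
    also have "\<dots> \<le> exp (Re w * s - Re z * s) * exp (- Re w * r) * (C * exp (\<omega> * r))"
      using C that by (intro mult_left_mono) auto
    also have "\<dots> = C * exp (Re w * s - Re z * s - Re w * r + \<omega> * r)"
      by (simp add: exp_add exp_diff exp_minus field_simps)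
    also have "\<dots> \<le> C * exp (- (m/2) * s - (m/2) * r)"
      using le C by (intro mult_left_mono) auto
    finally show ?thesis
      by (simp add: mult.assoc flip: exp_add)
  next
    case False
    then have "g s r = 0" by (simp add: g_def)
    then show ?thesis using C by simp
  qed
  have E: "integrable M (\<lambda>t. exp (- (m/2) * t))"
    using m integrable_exp_halfline[of "m/2"] by (simp add: M_def)
  have sp: "space M = {0..}" by (simp add: M_def)
  interpret sf: pair_sigma_finite M M
    unfolding M_def ..
  have "integrable (M \<Otimes>\<^sub>M M) (\<lambda>p. C * exp (- (m/2) * fst p) * exp (- (m/2) * snd p))"
  proof (rule sf.Fubini_integrable)
    show "(\<lambda>p. C * exp (- (m/2) * fst p) * exp (- (m/2) * snd p)) \<in> borel_measurable (M \<Otimes>\<^sub>M M)"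
      by measurable
  qed (use E C in \<open>auto simp: abs_mult\<close>)
  moreover have [measurable]: "case_prod g \<in> borel_measurable (M \<Otimes>\<^sub>M M)"
  proof -
    have "case_prod g = (\<lambda>p. if 0 \<le> fst p \<and> fst p \<le> snd p then
      exp ((w - z) * complex_of_real (fst p)) * (exp (- w * complex_of_real (snd p)) * f (snd p)) else 0)"
      by (auto simp: fun_eq_iff g_def)
    then show ?thesis by simp
  qed
  ultimately have "integrable (M \<Otimes>\<^sub>M M) (case_prod g)"
    by (rule Bochner_Integration.integrable_bound)
      (use gle in \<open>force simp: space_pair_measure sp intro!: AE_I2 order.trans[OF _ abs_ge_self]\<close>)
  then have fub: "(LINT r|M. LINT s|M. g s r) = (LINT s|M. LINT r|M. g s r)"
    by (rule sf.Fubini_integral)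
  have left: "(LINT s|M. LINT r|M. g s r) = (LINT s|M. exp (- z * complex_of_real s) * laplace (\<lambda>t. f (s + t)) w)"
  proof (rule Bochner_Integration.integral_cong)
    fix s assume "s \<in> space M"
    then have s: "s \<ge> 0" by (simp add: sp)
    have "(LINT r|M. g s r) = (LINT r|M. exp ((w - z) * complex_of_real s) *
       (indicator {s..} r *\<^sub>R (exp (- w * complex_of_real r) * f r)))"
      using s by (intro Bochner_Integration.integral_cong) (auto simp: g_def split: split_indicator)
    also have "\<dots> = exp ((w - z) * complex_of_real s) *
       (LINT r|lebesgue_on {s..}. exp (- w * complex_of_real r) * f r)"
      using s unfolding M_def integral_mult_right_zero by (subst integral_lebesgue_on_eq_indicator) auto
    also have "\<dots> = exp (- z * complex_of_real s) * laplace (\<lambda>t. f (s + t)) w"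
    proof -
      have "exp ((w - z) * complex_of_real s) = exp (- z * complex_of_real s) * exp (w * complex_of_real s)"
        by (simp add: algebra_simps flip: exp_add)
      then show ?thesis
        by (simp only: laplace_shift[OF s] mult.assoc)
    qed
    finally show "(LINT r|M. g s r) = exp (- z * complex_of_real s) * laplace (\<lambda>t. f (s + t)) w" .
  qed simp
  have right: "(LINT r|M. LINT s|M. g s r) =
      (LINT r|M. (exp (- z * complex_of_real r) * f r - exp (- w * complex_of_real r) * f r) / (w - z))"
  proof (rule Bochner_Integration.integral_cong)
    fix r assume "r \<in> space M"
    then have r: "r \<ge> 0" by (simp add: sp)
    have "(LINT s|M. g s r) = (LINT s|M. (indicator {0..r} s *\<^sub>R exp ((w - z) * complex_of_real s)) *
       (exp (- w * complex_of_real r) * f r))"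
      by (intro Bochner_Integration.integral_cong) (auto simp: g_def)
    also have "\<dots> = (LINT s|lebesgue_on {0..r}. exp ((w - z) * complex_of_real s)) *
       (exp (- w * complex_of_real r) * f r)"
      unfolding M_def integral_mult_left_zero by (subst integral_lebesgue_on_eq_indicator) auto
    also have "\<dots> = (exp ((w - z) * of_real r) - 1) / (w - z) * (exp (- w * complex_of_real r) * f r)"
      using r False by (subst integral_exp_lebesgue_on) auto
    also have "\<dots> = (exp (- z * complex_of_real r) * f r - exp (- w * complex_of_real r) * f r) / (w - z)"
    proof -
      have "exp ((w - z) * of_real r) * exp (- w * complex_of_real r) = exp (- z * complex_of_real r)"
        by (simp add: algebra_simps flip: exp_add)
      moreover have "E * e = e' \<Longrightarrow> (E - 1) / d * (e * x) = (e' * x - e * x) / d" for E e e' d x :: complex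
        by (auto simp: left_diff_distrib)
      ultimately show ?thesis by blast
    qed
    finally show "(LINT s|M. g s r) =
      (exp (- z * complex_of_real r) * f r - exp (- w * complex_of_real r) * f r) / (w - z)" .
  qed simp
  have right': "(LINT r|M. (exp (- z * complex_of_real r) * f r - exp (- w * complex_of_real r) * f r) / (w - z))
    = (laplace f z - laplace f w) / (w - z)"
    using exp_bounded_integrable[OF f z] exp_bounded_integrable[OF f w] by (simp add: laplace_def M_def)
  have "laplace (\<lambda>s. laplace (\<lambda>t. f (s + t)) w) z = (laplace f z - laplace f w) / (w - z)"
    unfolding laplace_def[of _ z] using fub left right right' by (simp only: M_def laplace_def[of _ z])
  then show ?thesis
    using False by (simp add: field_simps)
qed simp

section \<open>Uniqueness of the Laplace transform\<close>

lemma measurable_continuous_exp_minus: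
  fixes \<phi> :: "real \<Rightarrow> real"
  assumes "continuous_on UNIV \<phi>"
  shows "(\<lambda>t. \<phi> (exp (- t))) \<in> borel_measurable (lebesgue_on A)"
proof -
  have "continuous_on UNIV (\<lambda>t::real. \<phi> (exp (- t)))"
    by (rule continuous_on_compose2[OF assms]) (auto intro!: continuous_intros)
  then show ?thesis
    by (intro measurable_lebesgue_on borel_measurable_continuous_onI)
qed

text \<open>With \<open>u = exp (- t)\<close>, the zeros at \<open>z + n\<close> say that
  \<open>exp (- z * t) * f t\<close> integrates to 0 against every power of \<open>u\<close>.
  Linearity gives all polynomials in \<open>u\<close>, and uniform approximation on
  \<open>{0..1}\<close> gives every continuous \<open>\<phi>\<close>.\<close>

lemma laplace_eq_0_imp_integral_eq_0:
  assumes f: "exp_bounded \<omega> f" and z: "Re z > \<omega>" and zero: "\<And>n::nat. laplace f (z + of_nat n) = 0"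
    and \<phi>: "continuous_on UNIV \<phi>"
  shows "(LINT t|lebesgue_on {0..}. of_real (\<phi> (exp (- t)) :: real) * (exp (- z * complex_of_real t) * f t)) = 0"
proof -
  define M where "M = lebesgue_on {0::real..}"
  define h where "h t = exp (- z * complex_of_real t) * f t" for t
  have h: "integrable M h"
    using exp_bounded_integrable[OF f z] by (simp add: M_def h_def[abs_def])
  then have [measurable]: "h \<in> borel_measurable M" by auto
  have sp: "space M = {0..}" by (simp add: M_def)
  have int: "integrable M (\<lambda>t. of_real (\<psi> (exp (- t)) :: real) * h t)"
    if \<psi>: "continuous_on UNIV \<psi>" for \<psi>
  proof -
    \<comment> \<open>For \<open>t \<ge> 0\<close> the argument \<open>exp (- t)\<close> stays in
      \<open>{0..1}\<close>, so a bound on this compact interval suffices.\<close>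
    have "bounded (\<psi> ` {0..1})"
      using \<psi> continuous_on_subset by (intro compact_imp_bounded compact_continuous_image) auto
    then obtain B where "\<forall>v\<in>\<psi> ` {0..1}. norm v \<le> B"
      using bounded_iff[of "\<psi> ` {0..1}"] by blast
    then have B: "norm (\<psi> u) \<le> B" if "u \<in> {0..1}" for u
      using that by (rule bspec[OF _ imageI])
    have [measurable]: "(\<lambda>t. \<psi> (exp (- t))) \<in> borel_measurable M"
      unfolding M_def by (rule measurable_continuous_exp_minus[OF \<psi>])
    show ?thesis
    proof (rule Bochner_Integration.integrable_bound)
      show "integrable M (\<lambda>t. of_real B * h t)" using h by simp
      show "AE t in M. norm (of_real (\<psi> (exp (- t))) * h t) \<le> norm (of_real B * h t)"
      proof (rule AE_I2)
        fix t assume "t \<in> space M"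
        then have "norm (\<psi> (exp (- t))) \<le> B" by (intro B) (simp add: sp)
        then show "norm (of_real (\<psi> (exp (- t))) * h t) \<le> norm (of_real B * h t)"
          by (simp add: norm_mult mult_right_mono)
      qed
    qed measurable
  qed
  have pow: "(LINT t|M. of_real (exp (- t) ^ n) * h t) = 0" for n
  proof -
    have "of_real (exp (- t) ^ n) * h t = exp (- (z + of_nat n) * complex_of_real t) * f t" for t
    proof -
      have "complex_of_real (exp (- t) ^ n) = exp (- of_nat n * complex_of_real t)"
        by (simp flip: exp_of_nat_mult exp_of_real)
      moreover have "exp (- (z + of_nat n) * complex_of_real t)
          = exp (- of_nat n * complex_of_real t) * exp (- z * complex_of_real t)"
        by (simp add: algebra_simps flip: exp_add)
      ultimately show ?thesis
        by (simp only: h_def mult.assoc)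
    qed
    then show ?thesis
      using zero[of n] by (simp add: laplace_def M_def)
  qed
  have poly: "(LINT t|M. of_real (g (exp (- t))) * h t) = 0" if poly: "real_polynomial_function g" for g
  proof -
    obtain a n where g: "g = (\<lambda>x. \<Sum>i\<le>n. a i * x ^ i)"
      using poly by (auto simp: real_polynomial_function_iff_sum)
    have "(LINT t|M. of_real (g (exp (- t))) * h t)
        = (LINT t|M. (\<Sum>i\<le>n. of_real (a i) * (of_real (exp (- t) ^ i) * h t)))"
      by (simp add: g sum_distrib_right mult.assoc)
    also have "\<dots> = (\<Sum>i\<le>n. LINT t|M. of_real (a i) * (of_real (exp (- t) ^ i) * h t))"
      by (intro Bochner_Integration.integral_sum integrable_mult_right int continuous_intros)
    also have "\<dots> = 0"
      by (simp only: integral_mult_right_zero pow) simp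
    finally show ?thesis .
  qed
  define J where "J = (LINT t|M. norm (h t))"
  have J: "J \<ge> 0" unfolding J_def by (rule integral_nonneg_AE) simp
  have "norm (LINT t|M. of_real (\<phi> (exp (- t))) * h t) \<le> 0"
  proof (rule field_le_epsilon)
    fix e :: real assume e: "e > 0"
    \<comment> \<open>The summand 1 keeps the quotient defined when \<open>J = 0\<close>, and still
      \<open>d * J \<le> e\<close>.\<close>
    define d where "d = e / (J + 1)"
    have d: "d > 0" using e J by (simp add: d_def)
    obtain g where g: "real_polynomial_function g" "\<And>x. x \<in> {0..1} \<Longrightarrow> \<bar>\<phi> x - g x\<bar> < d"
      using Stone_Weierstrass_real_polynomial_function[OF compact_Icc continuous_on_subset[OF \<phi>] d]
      by (metis subset_UNIV)
    have cg: "continuous_on UNIV g"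
      using g(1) by (auto simp: real_polynomial_function_iff_sum intro!: continuous_intros)
    have "(LINT t|M. of_real (\<phi> (exp (- t))) * h t)
        = (LINT t|M. of_real (\<phi> (exp (- t))) * h t) - (LINT t|M. of_real (g (exp (- t))) * h t)"
      using poly[OF g(1)] by simp
    also have "\<dots> = (LINT t|M. of_real (\<phi> (exp (- t)) - g (exp (- t))) * h t)"
      using int[OF \<phi>] int[OF cg] by (simp add: left_diff_distrib)
    finally have eq: "(LINT t|M. of_real (\<phi> (exp (- t))) * h t)
        = (LINT t|M. of_real (\<phi> (exp (- t)) - g (exp (- t))) * h t)" .
    have "norm (LINT t|M. of_real (\<phi> (exp (- t))) * h t)
        \<le> (LINT t|M. norm (of_real (\<phi> (exp (- t)) - g (exp (- t))) * h t))"
      unfolding eq by (rule integral_norm_bound)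
    also have "\<dots> \<le> (LINT t|M. d * norm (h t))"
    proof (rule integral_mono)
      show "integrable M (\<lambda>t. norm (of_real (\<phi> (exp (- t)) - g (exp (- t))) * h t))"
        using \<phi> cg by (intro integrable_norm int continuous_intros)
      show "integrable M (\<lambda>t. d * norm (h t))" using h by simp
      fix t assume "t \<in> space M"
      then have "\<bar>\<phi> (exp (- t)) - g (exp (- t))\<bar> \<le> d"
        by (intro less_imp_le g) (simp add: sp)
      then show "norm (of_real (\<phi> (exp (- t)) - g (exp (- t))) * h t) \<le> d * norm (h t)"
        unfolding norm_mult norm_of_real by (rule mult_right_mono) simp
    qed
    also have "\<dots> = d * J" by (simp add: J_def)
    also have "\<dots> \<le> e" using e J by (simp add: d_def field_simps)
    finally show "norm (LINT t|M. of_real (\<phi> (exp (- t))) * h t) \<le> 0 + e" by simp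
  qed
  then show ?thesis by (simp add: M_def h_def)
qed

text \<open>The indicator of \<open>{s..}\<close> is a pointwise limit of continuous functions of
  \<open>exp (- t)\<close> bounded by 1, so dominated convergence carries the vanishing integrals
  over to it.\<close>

lemma laplace_eq_0_imp_tail_eq_0:
  assumes f: "exp_bounded \<omega> f" and z: "Re z > \<omega>" and zero: "\<And>n::nat. laplace f (z + of_nat n) = 0"
    and s: "s \<ge> 0"
  shows "(LINT t|lebesgue_on {s..}. exp (- z * complex_of_real t) * f t) = 0"
proof -
  define M where "M = lebesgue_on {0::real..}"
  define h where "h t = exp (- z * complex_of_real t) * f t" for t
  have h: "integrable M h"
    using exp_bounded_integrable[OF f z] by (simp add: M_def h_def[abs_def])
  then have [measurable]: "h \<in> borel_measurable M" by auto
  \<comment> \<open>For \<open>n > 0\<close> a ramp in \<open>u\<close>: it is 1 up to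
    \<open>exp (- s)\<close> and then falls with slope \<open>- n\<close> to 0. As
    \<open>u = exp (- t)\<close> decreases in \<open>t\<close>, the limit is 1 exactly for
    \<open>t \<ge> s\<close>, including the endpoint.\<close>
  define \<phi> where "\<phi> n u = max 0 (min 1 (1 - real n * (u - exp (- s))))" for n u
  have \<phi>: "continuous_on UNIV (\<phi> n)" for n
    unfolding \<phi>_def by (intro continuous_intros)
  have \<phi>1: "\<bar>\<phi> n u\<bar> \<le> 1" for n u by (simp add: \<phi>_def)
  have lim: "(\<lambda>n. \<phi> n (exp (- t))) \<longlonglongrightarrow> indicator {s..} t" for t
  proof (cases "s \<le> t")
    case True
    then have "\<phi> n (exp (- t)) = 1" for n
      using mult_nonneg_nonpos[of "real n" "exp (- t) - exp (- s)"] by (simp add: \<phi>_def)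
    then show ?thesis using True by simp
  next
    case False
    define \<delta> where "\<delta> = exp (- t) - exp (- s)"
    have \<delta>: "\<delta> > 0" using False by (simp add: \<delta>_def)
    have "eventually (\<lambda>n. \<phi> n (exp (- t)) = 0) sequentially"
      using eventually_ge_at_top[of "nat \<lceil>1 / \<delta>\<rceil>"]
    proof eventually_elim
      case (elim n)
      then have "1 / \<delta> \<le> real n" by linarith
      then have "1 \<le> real n * \<delta>" using \<delta> by (simp add: field_simps)
      then show ?case by (simp add: \<phi>_def \<delta>_def)
    qed
    then show ?thesis using False by (simp add: tendsto_eventually)
  qed
  have meas: "(\<lambda>t. \<phi> n (exp (- t))) \<in> borel_measurable M" for n
    unfolding M_def by (rule measurable_continuous_exp_minus[OF \<phi>])
  have "(\<lambda>n. LINT t|M. of_real (\<phi> n (exp (- t))) * h t)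
      \<longlonglongrightarrow> (LINT t|M. of_real (indicator {s..} t) * h t)"
  proof (rule integral_dominated_convergence)
    show "integrable M (\<lambda>t. norm (h t))" using h by simp
    have [measurable]: "(indicator {s..} :: real \<Rightarrow> real) \<in> borel_measurable M"
      unfolding M_def by (intro measurable_lebesgue_on) simp
    show "(\<lambda>t. of_real (indicator {s..} t) * h t) \<in> borel_measurable M" by measurable
    show "(\<lambda>t. of_real (\<phi> n (exp (- t))) * h t) \<in> borel_measurable M" for n
      using meas[of n] by measurable
    show "AE t in M. (\<lambda>n. of_real (\<phi> n (exp (- t))) * h t) \<longlonglongrightarrow> of_real (indicator {s..} t) * h t"
      by (intro AE_I2 tendsto_intros lim)
    show "AE t in M. norm (of_real (\<phi> n (exp (- t))) * h t) \<le> norm (h t)" for n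
      using mult_right_mono[OF \<phi>1 norm_ge_zero] by (intro AE_I2) (simp add: norm_mult)
  qed
  moreover have "(LINT t|M. of_real (\<phi> n (exp (- t))) * h t) = 0" for n
    using laplace_eq_0_imp_integral_eq_0[OF f z zero \<phi>] by (simp add: M_def h_def)
  ultimately have "(\<lambda>n. 0) \<longlonglongrightarrow> (LINT t|M. of_real (indicator {s..} t) * h t)"
    by simp
  then have "(LINT t|M. of_real (indicator {s..} t) * h t) = 0"
    by (simp add: tendsto_const_iff)
  then have "(LINT t|M. indicator {s..} t *\<^sub>R h t) = 0"
    by (simp add: scaleR_conv_of_real)
  then show ?thesis
    using s unfolding M_def h_def by (subst (asm) integral_lebesgue_on_eq_indicator) auto
qed

text \<open>The positive and negative parts are densities of two finite measures that agree on all
  rays. Rays determine such measures, and densities are unique almost everywhere, so the two parts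
  coincide.\<close>

lemma AE_eq_0_if_integral_greaterThan_eq_0:
  fixes h :: "real \<Rightarrow> real"
  assumes h: "integrable lebesgue h"
    and zero: "\<And>s. (\<integral>t. indicator {s<..} t * h t \<partial>lebesgue) = 0"
  shows "AE t in lebesgue. h t = 0"
proof -
  \<comment> \<open>The comparison of measures on rays concerns Borel measures, so the Lebesgue
    measurable \<open>h\<close> is replaced by a Borel version.\<close>
  obtain g where g[measurable]: "g \<in> borel_measurable lborel" and eq: "AE t in lborel. h t = g t"
    using completion_ex_borel_measurable_real borel_measurable_integrable[OF h] by blast
  have eq': "AE t in lebesgue. h t = g t"
    using eq by (rule AE_completion)
  have gl[measurable]: "g \<in> borel_measurable lebesgue"
    using g by (simp add: measurable_completion)
  have hl[measurable]: "h \<in> borel_measurable lebesgue"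
    using h by blast
  have "integrable lebesgue g"
    using h eq' integrable_cong_AE[OF hl gl] by blast
  then have ig: "integrable lborel g"
    using integrable_completion[OF g] by simp
  have zero': "(\<integral>t. indicator {s<..} t * g t \<partial>lborel) = 0" for s
  proof -
    have [measurable]: "(indicator {s<..} :: real \<Rightarrow> real) \<in> borel_measurable lebesgue"
      by (simp add: borel_measurable_indicator)
    have "(\<integral>t. indicator {s<..} t * g t \<partial>lborel) = (\<integral>t. indicator {s<..} t * g t \<partial>lebesgue)"
      by (rule integral_completion[symmetric]) measurable
    also have "\<dots> = (\<integral>t. indicator {s<..} t * h t \<partial>lebesgue)"
      using eq' by (intro integral_cong_AE) (auto elim: eventually_mono)
    finally show ?thesis using zero by simp
  qed
  define p where "p t = max 0 (g t)" for t
  define q where "q t = max 0 (- g t)" for t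
  have pq: "integrable lborel p" "integrable lborel q"
    using ig by (auto simp: p_def[abs_def] q_def[abs_def] intro!: integrable_max)
  have int: "integrable lborel (\<lambda>t. indicator {s<..} t * r t)" if "integrable lborel r" for r :: "real \<Rightarrow> real" and s
    using integrable_mult_indicator[OF _ that, of "{s<..}"] by simp
  have em: "emeasure (density lborel (\<lambda>t. ennreal (r t))) {s<..} = ennreal (\<integral>t. indicator {s<..} t * r t \<partial>lborel)"
    if "integrable lborel r" "\<And>t. r t \<ge> 0" for r :: "real \<Rightarrow> real" and s
  proof -
    have "emeasure (density lborel (\<lambda>t. ennreal (r t))) {s<..} = (\<integral>\<^sup>+t. ennreal (indicator {s<..} t * r t) \<partial>lborel)"
      using borel_measurable_integrable[OF that(1)]
      by (subst emeasure_density) (auto intro!: nn_integral_cong split: split_indicator)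
    also have "\<dots> = ennreal (\<integral>t. indicator {s<..} t * r t \<partial>lborel)"
      using that(2) by (intro nn_integral_eq_integral int[OF that(1)]) simp
    finally show ?thesis .
  qed
  have "density lborel (\<lambda>t. ennreal (p t)) = density lborel (\<lambda>t. ennreal (q t))"
  proof (rule measure_eqI_lessThan)
    fix s
    have "(\<integral>t. indicator {s<..} t * p t \<partial>lborel) - (\<integral>t. indicator {s<..} t * q t \<partial>lborel)
        = (\<integral>t. indicator {s<..} t * p t - indicator {s<..} t * q t \<partial>lborel)"
      using int[OF pq(1)] int[OF pq(2)] by simp
    also have "\<dots> = (\<integral>t. indicator {s<..} t * g t \<partial>lborel)"
      by (intro Bochner_Integration.integral_cong) (auto simp: p_def q_def max_def)
    finally have "(\<integral>t. indicator {s<..} t * p t \<partial>lborel) = (\<integral>t. indicator {s<..} t * q t \<partial>lborel)"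
      using zero' by simp
    then show "emeasure (density lborel (\<lambda>t. ennreal (p t))) {s<..} = emeasure (density lborel (\<lambda>t. ennreal (q t))) {s<..}"
      using em[OF pq(1)] em[OF pq(2)] by (simp add: p_def q_def)
    show "emeasure (density lborel (\<lambda>t. ennreal (p t))) {s<..} < \<infinity>"
      using em[OF pq(1)] by (simp add: p_def)
  qed simp_all
  then have "AE t in lborel. ennreal (p t) = ennreal (q t)"
    using borel_measurable_integrable[OF pq(1)] borel_measurable_integrable[OF pq(2)]
    by (intro sigma_finite_measure.density_unique[OF sigma_finite_lborel]) simp_all
  \<comment> \<open>At each \<open>t\<close> at least one of \<open>p t\<close> and
    \<open>q t\<close> is 0, so their equality makes both vanish.\<close>
  then have "AE t in lborel. g t = 0"
    by eventually_elim (auto simp: p_def q_def max_def split: if_splits)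
  with eq have "AE t in lborel. h t = 0"
    by eventually_elim simp
  then show ?thesis by (rule AE_completion)
qed

text \<open>The weighted function, extended by 0 to the negative axis, has vanishing integrals over
  all rays. The real criterion then applies to its real and imaginary parts, and the exponential
  weight has no zeros.\<close>

lemma laplace_eq_0_imp_AE_eq_0:
  assumes f: "exp_bounded \<omega> f" and z: "Re z > \<omega>" and zero: "\<And>n::nat. laplace f (z + of_nat n) = 0"
  shows "AE t in lebesgue_on {0..}. f t = 0"
proof -
  define h where "h t = indicator {0..} t *\<^sub>R (exp (- z * complex_of_real t) * f t)" for t
  have h: "integrable lebesgue h"
    using exp_bounded_integrable[OF f z] by (simp add: integrable_restrict_space h_def[abs_def])
  have tail: "(\<integral>t. indicator {s<..} t *\<^sub>R h t \<partial>lebesgue) = 0" for s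
  proof -
    have [measurable]: "h \<in> borel_measurable lebesgue"
      "(indicator {s<..} :: real \<Rightarrow> real) \<in> borel_measurable lebesgue"
      "(indicator {max 0 s..} :: real \<Rightarrow> real) \<in> borel_measurable lebesgue"
      using h by (auto intro: borel_measurable_indicator)
    \<comment> \<open>The open ray differs from the closed tail only at \<open>s\<close> on the
      support of \<open>h\<close>, which also explains the \<open>max 0 s\<close>.\<close>
    have "AE t in lebesgue. t \<noteq> s"
      by (intro AE_completion AE_lborel_singleton)
    then have "AE t in lebesgue. indicator {s<..} t *\<^sub>R h t = indicator {max 0 s..} t *\<^sub>R h t"
      by eventually_elim (auto simp: h_def indicator_def)
    then have "(\<integral>t. indicator {s<..} t *\<^sub>R h t \<partial>lebesgue) = (\<integral>t. indicator {max 0 s..} t *\<^sub>R h t \<partial>lebesgue)"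
      by (intro integral_cong_AE) measurable
    also have "\<dots> = (\<integral>t. indicator {max 0 s..} t *\<^sub>R (exp (- z * complex_of_real t) * f t) \<partial>lebesgue)"
      by (intro Bochner_Integration.integral_cong) (auto simp: h_def indicator_def)
    also have "\<dots> = (LINT t|lebesgue_on {max 0 s..}. exp (- z * complex_of_real t) * f t)"
      by (simp add: integral_restrict_space)
    also have "\<dots> = 0"
      by (rule laplace_eq_0_imp_tail_eq_0[OF f z zero]) simp
    finally show ?thesis .
  qed
  have ind: "integrable lebesgue (\<lambda>t. indicator {s<..} t *\<^sub>R h t)" for s :: real
    using h by (intro integrable_mult_indicator) auto
  have "AE t in lebesgue. Re (h t) = 0"
  proof (rule AE_eq_0_if_integral_greaterThan_eq_0)
    show "(\<integral>t. indicator {s<..} t * Re (h t) \<partial>lebesgue) = 0" for s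
      using integral_Re[OF ind[of s]] by (simp add: tail)
  qed (use h in simp)
  moreover have "AE t in lebesgue. Im (h t) = 0"
  proof (rule AE_eq_0_if_integral_greaterThan_eq_0)
    show "(\<integral>t. indicator {s<..} t * Im (h t) \<partial>lebesgue) = 0" for s
      using integral_Im[OF ind[of s]] by (simp add: tail)
  qed (use h in simp)
  ultimately have "AE t in lebesgue. t \<in> {0..} \<longrightarrow> f t = 0"
  proof eventually_elim
    case (elim t)
    then have "h t = 0" by (intro complex_eqI) simp_all
    then show ?case by (simp add: h_def indicator_def)
  qed
  then show ?thesis
    by (subst AE_restrict_space_iff) simp_all
qed

section \<open>Adjoints and Neumann series on norming dual pairs\<close>

lemma clinear_add: "clinear f \<Longrightarrow> f (x + y) = f x + f y"
  and clinear_scaleC: "clinear f \<Longrightarrow> f (c *\<^sub>C x) = c *\<^sub>C f x"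
  by (auto simp: Vector_Spaces.linear_iff)

lemma clinear_diff: "clinear f \<Longrightarrow> f (x - y) = f x - f y"
  using clinear_add[of f "x - y" y] by simp

lemma clinearI:
  assumes "\<And>x y. f (x + y) = f x + f y" "\<And>c x. f (c *\<^sub>C x) = c *\<^sub>C f x"
  shows "clinear f"
  using assms by (simp add: Vector_Spaces.linear_iff complex_vector.vector_space_axioms)

text \<open>The solutions are the fixed points of \<open>y + c *\<^sub>C R x\<close> as a map of
  \<open>x\<close>, a contraction of a complete space.\<close>

lemma ex1_minus_scaleC_eq:
  fixes R :: "'a::complex_banach \<Rightarrow> 'a"
  assumes R: "clinear R" and K: "\<And>x. norm (R x) \<le> K * norm x" "cmod c * K < 1"
  shows "\<exists>!x. x - c *\<^sub>C R x = y"
proof -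
  have "\<exists>!x. y + c *\<^sub>C R x = x"
  proof (rule banach_fix_type)
    \<comment> \<open>The sign of \<open>K\<close> is open here, while a contraction constant must
      be nonnegative; hence \<open>max 0 K\<close>.\<close>
    show "0 \<le> cmod c * max 0 K" "cmod c * max 0 K < 1"
      using K(2) by (auto simp: max_def)
    show "\<forall>u v. dist (y + c *\<^sub>C R u) (y + c *\<^sub>C R v) \<le> cmod c * max 0 K * dist u v"
    proof (intro allI)
      fix u v
      have "dist (y + c *\<^sub>C R u) (y + c *\<^sub>C R v) = norm (c *\<^sub>C R (u - v))"
        by (simp add: dist_norm clinear_diff[OF R] complex_vector.scale_right_diff_distrib)
      also have "\<dots> = cmod c * norm (R (u - v))"
        by (rule norm_scaleC)
      also have "\<dots> \<le> cmod c * (max 0 K * norm (u - v))"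
        using order.trans[OF K(1) mult_right_mono[of K "max 0 K" "norm (u - v)"]]
        by (intro mult_left_mono) auto
      finally show "dist (y + c *\<^sub>C R u) (y + c *\<^sub>C R v) \<le> cmod c * max 0 K * dist u v"
        by (simp add: dist_norm mult.assoc)
    qed
  qed
  moreover have "y + c *\<^sub>C R x = x \<longleftrightarrow> x - c *\<^sub>C R x = y" for x
    by (auto simp: algebra_simps)
  ultimately show ?thesis by simp
qed

context norming_dual_pair
begin

text \<open>The axioms are symmetric in the two spaces. This transfers norm bounds and separation to
  the right-hand space, where adjoints act.\<close>

lemma norming_dual_pair_flip: "norming_dual_pair (\<lambda>y x. pairing x y)"
proof (rule norming_dual_pair.intro)
qed (rule nontrivial_left nontrivial_right clinear_left clinear_right norming_left norming_right)+

lemmas pairing_simps =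
  clinear_add[OF clinear_left] clinear_add[OF clinear_right]
  clinear_diff[OF clinear_left] clinear_diff[OF clinear_right]
  clinear_scaleC[OF clinear_left] clinear_scaleC[OF clinear_right]
  scaleC_complex_def

lemma norm_leI:
  assumes "\<And>y. cmod (pairing x y) \<le> K * norm y" "K \<ge> 0"
  shows "norm x \<le> K"
proof -
  have "ereal (norm x) \<le> ereal K"
    unfolding norming_left
  proof (rule SUP_least)
    fix y :: 'y assume "y \<in> {y. norm y \<le> 1}"
    then show "ereal (cmod (pairing x y)) \<le> ereal K"
      using order.trans[OF assms(1) mult_left_le[OF _ assms(2)]] by simp
  qed
  then show ?thesis by simp
qed

lemma cmod_pairing_le: "cmod (pairing x y) \<le> norm x * norm y"
proof (cases "y = 0")
  case True
  then show ?thesis using clinear_scaleC[OF clinear_right, of x 0 0] by (simp add: scaleC_complex_def)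
next
  case False
  define v where "v = complex_of_real (1 / norm y) *\<^sub>C y"
  have "norm v \<le> 1" using False by (simp add: v_def norm_scaleC norm_divide)
  then have "ereal (cmod (pairing x v)) \<le> ereal (norm x)"
    unfolding norming_left by (intro SUP_upper) simp
  then show ?thesis
    using False by (simp add: v_def pairing_simps norm_mult norm_divide field_simps)
qed

lemma eq_if_pairing_eq:
  assumes "\<And>y. pairing x y = pairing x' y"
  shows "x = x'"
  using norm_leI[of "x - x'" 0] assms by (simp add: pairing_simps)

section \<open>The weak topology and adjoints of weakly continuous operators\<close>

lemma topspace_weak_topology [simp]: "topspace (weak_topology pairing) = UNIV"
  unfolding weak_topology_def topology_generated_by_topspace by blast

lemma openin_weak_topology_vimage:
  "open U \<Longrightarrow> openin (weak_topology pairing) {x. pairing x y \<in> U}"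
  unfolding weak_topology_def by (rule topology_generated_by_Basis) blast

text \<open>Induction over the generation of the topology from its subbasis, for all points at once.
  An intersection joins the two finite sets of functionals and takes the smaller radius.\<close>

lemma openin_weak_topologyD:
  assumes "openin (weak_topology pairing) U" "x \<in> U"
  shows "\<exists>F e. finite F \<and> e > 0 \<and> (\<forall>z. (\<forall>y\<in>F. cmod (pairing (z - x) y) < e) \<longrightarrow> z \<in> U)"
proof -
  have "generate_topology_on {{x. pairing x y \<in> U} | y U. open U} U"
    using assms(1) by (simp add: weak_topology_def openin_topology_generated_by_iff)
  then show ?thesis
    using assms(2)
  proof (induction arbitrary: x)
    case (Int a b)
    obtain F e where F: "finite F" "e > 0" "\<forall>z. (\<forall>y\<in>F. cmod (pairing (z - x) y) < e) \<longrightarrow> z \<in> a"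
      using Int.IH(1)[of x] Int.prems by blast
    obtain G d where G: "finite G" "d > 0" "\<forall>z. (\<forall>y\<in>G. cmod (pairing (z - x) y) < d) \<longrightarrow> z \<in> b"
      using Int.IH(2)[of x] Int.prems by blast
    have "\<forall>z. (\<forall>y\<in>F \<union> G. cmod (pairing (z - x) y) < min e d) \<longrightarrow> z \<in> a \<inter> b"
      using F(3) G(3) by simp
    then show ?case
      using F(1,2) G(1,2) by (intro exI[of _ "F \<union> G"] exI[of _ "min e d"]) simp
  next
    case (UN K)
    then obtain k where k: "k \<in> K" "x \<in> k" by blast
    obtain F e where "finite F" "e > 0" "\<forall>z. (\<forall>y\<in>F. cmod (pairing (z - x) y) < e) \<longrightarrow> z \<in> k"
      using UN.IH[OF k] by blast
    then show ?case
      using k(1) by (intro exI[of _ F] exI[of _ e]) blast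
  next
    case (Basis s)
    then obtain y U where s: "s = {x. pairing x y \<in> U}" "open U" by blast
    with Basis obtain e where "e > 0" "\<forall>u. dist u (pairing x y) < e \<longrightarrow> u \<in> U"
      by (auto simp: open_dist)
    then show ?case
      by (intro exI[of _ "{y}"] exI[of _ e]) (auto simp: s dist_norm pairing_simps)
  qed simp
qed

text \<open>The classical fact that a functional vanishing on the common kernel of finitely many
  functionals is a linear combination of them; here the combination is again an element of the
  right-hand space.\<close>

lemma functional_eq_pairing_if_kernel:
  assumes "finite F" "clinear \<phi>" "\<And>z. (\<forall>y\<in>F. pairing z y = 0) \<Longrightarrow> \<phi> z = (0::complex)"
  shows "\<exists>y. \<forall>x. \<phi> x = pairing x y"
  using assms
proof (induction F arbitrary: \<phi> rule: finite_induct)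
  case empty
  then show ?case
    using clinear_scaleC[OF clinear_right, of _ 0 0] by (intro exI[of _ 0]) (simp add: scaleC_complex_def)
next
  case (insert y F)
  show ?case
  proof (cases "\<forall>z. (\<forall>y\<in>F. pairing z y = 0) \<longrightarrow> pairing z y = 0")
    case True
    then show ?thesis using insert by auto
  next
    case False
    then obtain u where u: "\<forall>y\<in>F. pairing u y = 0" "pairing u y \<noteq> 0" by blast
    \<comment> \<open>Subtracting a multiple of the functional \<open>y\<close>, chosen to kill
      \<open>u\<close>, produces a functional that vanishes on the common kernel of \<open>F\<close>
      alone: each \<open>z\<close> there is a multiple of \<open>u\<close> plus an element of the
      smaller kernel.\<close>
    define \<psi> where "\<psi> x = \<phi> x - pairing x y * (\<phi> u / pairing u y)" for x
    have "clinear \<psi>"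
      by (rule clinearI) (simp_all add: \<psi>_def clinear_add[OF insert(4)] clinear_scaleC[OF insert(4)]
          pairing_simps algebra_simps)
    moreover have "\<psi> z = 0" if z: "\<forall>y\<in>F. pairing z y = 0" for z
    proof -
      have "\<phi> (z - (pairing z y / pairing u y) *\<^sub>C u) = 0"
        using u z by (intro insert(5)) (auto simp: pairing_simps)
      then show ?thesis
        by (simp add: clinear_diff[OF insert(4)] clinear_scaleC[OF insert(4)] scaleC_complex_def \<psi>_def)
    qed
    ultimately obtain v where v: "\<forall>x. \<psi> x = pairing x v"
      using insert.IH by blast
    have "\<phi> x = pairing x (v + (\<phi> u / pairing u y) *\<^sub>C y)" for x
      using v[rule_format, of x] by (simp add: \<psi>_def pairing_simps algebra_simps)
    then show ?thesis by blast
  qed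
qed

text \<open>Replaces continuity by the existence of an adjoint. A weakly continuous functional is
  bounded on a neighbourhood given by finitely many functionals, so it vanishes on their common
  kernel and is itself given by the pairing.\<close>

lemma weakly_continuous_operators_iff:
  "R \<in> weakly_continuous_operators pairing \<longleftrightarrow>
    clinear R \<and> (\<exists>R'. \<forall>x y. pairing (R x) y = pairing x (R' y))"
proof (intro iffI conjI)
  assume "R \<in> weakly_continuous_operators pairing"
  then have lin: "clinear R" and cont: "continuous_map (weak_topology pairing) (weak_topology pairing) R"
    by (auto simp: weakly_continuous_operators_def)
  show "clinear R" by fact
  have "\<exists>y'. \<forall>x. pairing (R x) y = pairing x y'" for y
  proof -
    have "openin (weak_topology pairing) {x. R x \<in> {x. pairing x y \<in> ball 0 1}}"
      using openin_continuous_map_preimage[OF cont openin_weak_topology_vimage[OF open_ball, of y 0 1]] by simp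
    moreover have "R 0 = 0" using clinear_scaleC[OF lin, of 0 0] by simp
    moreover have "pairing 0 y = 0"
      using clinear_scaleC[OF clinear_left, of 0 0] by (simp add: scaleC_complex_def)
    ultimately obtain F e where F: "finite F" "e > 0"
      and imp: "\<And>z. (\<forall>y\<in>F. cmod (pairing z y) < e) \<Longrightarrow> cmod (pairing (R z) y) < 1"
      using openin_weak_topologyD[of "{x. R x \<in> {x. pairing x y \<in> ball 0 1}}" 0] by auto
    show ?thesis
    proof (rule functional_eq_pairing_if_kernel[OF F(1)])
      show "clinear (\<lambda>x. pairing (R x) y)"
        by (rule clinearI) (simp_all add: clinear_add[OF lin] clinear_scaleC[OF lin] pairing_simps)
      fix z assume z: "\<forall>y\<in>F. pairing z y = 0"
      show "pairing (R z) y = 0"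
      proof (rule ccontr)
        assume nz: "pairing (R z) y \<noteq> 0"
        \<comment> \<open>All pairings with \<open>F\<close> are 0, so every multiple of
          \<open>z\<close> lies in the neighbourhood; this multiple is scaled to give the value
          1.\<close>
        have "cmod (pairing (R ((1 / pairing (R z) y) *\<^sub>C z)) y) < 1"
          using z F(2) by (intro imp) (simp add: pairing_simps)
        then show False
          using nz by (simp add: clinear_scaleC[OF lin] pairing_simps)
      qed
    qed
  qed
  then show "\<exists>R'. \<forall>x y. pairing (R x) y = pairing x (R' y)" by metis
next
  assume "clinear R \<and> (\<exists>R'. \<forall>x y. pairing (R x) y = pairing x (R' y))"
  then obtain R' where "clinear R" and R': "\<And>x y. pairing (R x) y = pairing x (R' y)" by blast
  moreover have "continuous_map (weak_topology pairing) (weak_topology pairing) R"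
    \<comment> \<open>Only the target topology is unfolded, so that preimages need to be tested on
      its subbasis alone.\<close>
    unfolding weak_topology_def[of pairing, THEN arg_cong[of _ _ "\<lambda>X. continuous_map _ X R"]]
  proof (rule continuous_on_generated_topo)
    fix U assume "U \<in> {{x. pairing x y \<in> U} | y U. open U}"
    then obtain y V where U: "U = {x. pairing x y \<in> V}" "open V" by blast
    then have "R -` U \<inter> topspace (weak_topology pairing) = {x. pairing x (R' y) \<in> V}"
      by (auto simp: R')
    then show "openin (weak_topology pairing) (R -` U \<inter> topspace (weak_topology pairing))"
      using openin_weak_topology_vimage[OF U(2)] by simp
  next
    show "R ` topspace (weak_topology pairing) \<subseteq> \<Union> {{x. pairing x y \<in> U} | y U. open U}"
      using open_UNIV by blast
  qed
  ultimately show "R \<in> weakly_continuous_operators pairing"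
    by (simp add: weakly_continuous_operators_def)
qed

section \<open>Bounds for adjoints and weak continuity of the Neumann series\<close>

lemma norm_adjoint_le:
  assumes adj: "\<And>x y. pairing (R x) y = pairing x (R' y)"
    and K: "\<And>x. norm (R x) \<le> K * norm x" "K \<ge> 0"
  shows "norm (R' y) \<le> K * norm y"
proof (rule norming_dual_pair.norm_leI[OF norming_dual_pair_flip])
  fix x
  have "cmod (pairing x (R' y)) \<le> norm (R x) * norm y"
    by (simp add: cmod_pairing_le flip: adj)
  also have "\<dots> \<le> K * norm x * norm y"
    by (intro mult_right_mono K) simp
  finally show "cmod (pairing x (R' y)) \<le> K * norm y * norm x"
    by (simp add: mult_ac)
qed (use K in simp)

lemma clinear_adjoint:
  assumes adj: "\<And>x y. pairing (R x) y = pairing x (R' y)"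
  shows "clinear R'"
  by (rule clinearI; rule norming_dual_pair.eq_if_pairing_eq[OF norming_dual_pair_flip])
    (simp_all add: pairing_simps flip: adj)

text \<open>\<open>Q\<close> is the Neumann series \<open>R (1 - c R)\<^sup>-\<^sup>1\<close>; its adjoint is \<open>R' (1 - c R')\<^sup>-\<^sup>1\<close>.\<close>

lemma weakly_continuous_neumann:
  assumes R: "R \<in> weakly_continuous_operators pairing"
    and K: "\<And>x. norm (R x) \<le> K * norm x" "K \<ge> 0" "cmod c * K < 1"
  shows "\<exists>Q \<in> weakly_continuous_operators pairing.
    (\<forall>x. Q (x - c *\<^sub>C R x) = R x) \<and> surj (\<lambda>x. x - c *\<^sub>C R x)"
proof -
  obtain R' where lin: "clinear R" and adj: "\<And>x y. pairing (R x) y = pairing x (R' y)"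
    using R weakly_continuous_operators_iff by blast
  define V where "V u = (THE x. x - c *\<^sub>C R x = u)" for u
  have V: "V u - c *\<^sub>C R (V u) = u" for u
    unfolding V_def by (rule theI') (rule ex1_minus_scaleC_eq[OF lin K(1,3)])
  have V_eq: "V u = x" if "x - c *\<^sub>C R x = u" for u x
    using ex1_minus_scaleC_eq[OF lin K(1,3), of u] V that by blast
  have linV: "clinear V"
  proof (rule clinearI; rule V_eq)
    fix u v
    have "V u + V v - c *\<^sub>C R (V u + V v) = (V u - c *\<^sub>C R (V u)) + (V v - c *\<^sub>C R (V v))"
      by (simp add: clinear_add[OF lin] scaleC_add_right)
    then show "V u + V v - c *\<^sub>C R (V u + V v) = u + v" by (simp only: V)
  next
    fix a u
    have "a *\<^sub>C V u - c *\<^sub>C R (a *\<^sub>C V u) = a *\<^sub>C (V u - c *\<^sub>C R (V u))"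
      by (simp add: clinear_scaleC[OF lin] complex_vector.scale_right_diff_distrib mult.commute)
    then show "a *\<^sub>C V u - c *\<^sub>C R (a *\<^sub>C V u) = a *\<^sub>C u" by (simp only: V)
  qed
  obtain W where W: "\<And>y. W y - c *\<^sub>C R' (W y) = y"
    using ex1_minus_scaleC_eq[OF clinear_adjoint[OF adj] norm_adjoint_le[OF adj K(1,2)] K(3)] by metis
  have "pairing (R (V x)) y = pairing x (R' (W y))" for x y
  proof -
    \<comment> \<open>The term with \<open>c\<close> is the same on both sides, and the remaining
      terms agree after moving \<open>R\<close> across the pairing once.\<close>
    have "pairing (R (V x)) (W y - c *\<^sub>C R' (W y)) = pairing (V x - c *\<^sub>C R (V x)) (R' (W y))"
      by (simp add: pairing_simps adj)
    then show ?thesis by (simp only: V W)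
  qed
  moreover have "clinear (\<lambda>x. R (V x))"
    by (rule clinearI) (simp_all add: clinear_add[OF lin] clinear_scaleC[OF lin] clinear_add[OF linV] clinear_scaleC[OF linV])
  ultimately have "(\<lambda>x. R (V x)) \<in> weakly_continuous_operators pairing"
    unfolding weakly_continuous_operators_iff by (intro conjI exI[of _ "\<lambda>y. R' (W y)"]) auto
  moreover have "R (V (x - c *\<^sub>C R x)) = R x" for x
    using V_eq[OF refl] by simp
  moreover have "surj (\<lambda>x. x - c *\<^sub>C R x)"
    using V by (metis surj_def)
  ultimately show ?thesis
    by (intro bexI[of _ "\<lambda>x. R (V x)"] conjI allI)
qed

end

section \<open>The resolvent identity for integrable semigroups\<close>

lemma laplace_cong: "(\<And>t. t \<ge> 0 \<Longrightarrow> f t = g t) \<Longrightarrow> laplace f z = laplace g z"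
  unfolding laplace_def by (intro Bochner_Integration.integral_cong) auto

context norming_dual_pair
begin

lemma laplace_operator_iff:
  "laplace_operator pairing T z R \<longleftrightarrow> R \<in> weakly_continuous_operators pairing \<and>
    (\<forall>x y. pairing (R x) y = laplace (\<lambda>t. pairing (T t x) y) z)"
  by (simp add: laplace_operator_def laplace_def)

lemma laplace_transform_eq:
  assumes "laplace_operator pairing T z R"
  shows "laplace_transform pairing T z = R"
  unfolding laplace_transform_def
proof (rule the_equality)
  show "laplace_operator pairing T z R" by fact
next
  fix Q assume Q: "laplace_operator pairing T z Q"
  show "Q = R"
    by (rule ext, rule eq_if_pairing_eq) (use assms Q in \<open>simp add: laplace_operator_iff\<close>)
qed

end

text \<open>The existence of a transform is split off from \<open>integrable_semigroup\<close> and
  passed as explicit \<open>laplace_operator\<close> premises. Thus two semigroups can be given one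
  common type and share one \<open>R\<close>, even though the original point
  \<open>\<mu>\<^sub>0\<close> may lie left of an enlarged \<open>\<omega>\<close>.\<close>

locale measurable_semigroup = norming_dual_pair pairing
  for pairing :: "'x::complex_banach \<Rightarrow> 'y::complex_banach \<Rightarrow> complex" +
  fixes M \<omega> :: real and T :: "real \<Rightarrow> 'x \<Rightarrow> 'x"
  assumes type: "semigroup_of_type pairing M \<omega> T"
    and measurable: "\<And>x y. (\<lambda>t. pairing (T t x) y) \<in> borel_measurable (lebesgue_on {0..})"
begin

lemma clinear_T: "t \<ge> 0 \<Longrightarrow> clinear (T t)"
  and T_add: "s \<ge> 0 \<Longrightarrow> t \<ge> 0 \<Longrightarrow> T (s + t) x = T s (T t x)"
  and T_zero: "T 0 = id"
  and M_ge_1: "M \<ge> 1"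
  and norm_T_le: "t \<ge> 0 \<Longrightarrow> norm (T t x) \<le> M * exp (\<omega> * t) * norm x"
  using type by (auto simp: semigroup_of_type_def semigroup_on_def weakly_continuous_operators_iff)

lemma adjoint_T: "t \<ge> 0 \<Longrightarrow> \<exists>T'. \<forall>x y. pairing (T t x) y = pairing x (T' y)"
  using type by (auto simp: semigroup_of_type_def semigroup_on_def weakly_continuous_operators_iff)

lemma cmod_pairing_T_le:
  assumes "t \<ge> 0"
  shows "cmod (pairing (T t x) y) \<le> M * norm x * norm y * exp (\<omega> * t)"
proof -
  have "cmod (pairing (T t x) y) \<le> norm (T t x) * norm y"
    by (rule cmod_pairing_le)
  also have "\<dots> \<le> M * exp (\<omega> * t) * norm x * norm y"
    by (intro mult_right_mono norm_T_le assms) simp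
  finally show ?thesis by (simp add: mult_ac)
qed

lemma exp_bounded_T: "exp_bounded \<omega> (\<lambda>t. pairing (T t x) y)"
  unfolding exp_bounded_def using measurable cmod_pairing_T_le M_ge_1
  by (intro conjI exI[of _ "M * norm x * norm y"]) auto

lemma norm_laplace_operator_le:
  assumes "laplace_operator pairing T z R" and z: "Re z > \<omega>"
  shows "norm (R x) \<le> M / (Re z - \<omega>) * norm x"
proof (rule norm_leI)
  fix y
  have "cmod (pairing (R x) y) = cmod (laplace (\<lambda>t. pairing (T t x) y) z)"
    using assms(1) by (simp add: laplace_operator_iff)
  also have "\<dots> \<le> M * norm x * norm y / (Re z - \<omega>)"
    by (rule cmod_laplace_le[OF measurable cmod_pairing_T_le z])
  finally show "cmod (pairing (R x) y) \<le> M / (Re z - \<omega>) * norm x * norm y"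
    by simp
qed (use z M_ge_1 in simp)

text \<open>Moving \<open>T s\<close> to the right argument by its adjoint brings it under the
  integral, where the semigroup law turns it into a translation.\<close>

lemma pairing_T_laplace_operator:
  assumes R: "laplace_operator pairing T w R" and s: "s \<ge> 0"
  shows "pairing (T s (R x)) y = laplace (\<lambda>t. pairing (T (s + t) x) y) w"
proof -
  obtain T' where T': "\<And>x y. pairing (T s x) y = pairing x (T' y)"
    using adjoint_T[OF s] by blast
  have "pairing (T s (R x)) y = laplace (\<lambda>t. pairing (T t x) (T' y)) w"
    using R by (simp add: T' laplace_operator_iff)
  also have "\<dots> = laplace (\<lambda>t. pairing (T (s + t) x) y) w"
    by (rule laplace_cong) (simp add: T_add[OF s] flip: T')
  finally show ?thesis .
qed

text \<open>The identity \<open>R(z) (1 - (w - z) R(w)) = R(w)\<close> in weak form, obtained from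
  \<open>laplace_laplace_shift\<close>. The left side is only an integral, since the operator at
  \<open>z\<close> is yet to be constructed.\<close>

lemma resolvent_identity:
  assumes R: "laplace_operator pairing T w R" and w: "Re w > \<omega>" and z: "Re z > \<omega>"
  shows "laplace (\<lambda>t. pairing (T t (x - (w - z) *\<^sub>C R x)) y) z = pairing (R x) y"
proof -
  have "laplace (\<lambda>t. pairing (T t (x - (w - z) *\<^sub>C R x)) y) z
      = laplace (\<lambda>t. pairing (T t x) y - pairing (T t ((w - z) *\<^sub>C R x)) y) z"
    by (rule laplace_cong) (simp add: clinear_diff[OF clinear_T] pairing_simps)
  also have "\<dots> = laplace (\<lambda>t. pairing (T t x) y) z - laplace (\<lambda>t. pairing (T t ((w - z) *\<^sub>C R x)) y) z"
    by (rule laplace_diff[OF exp_bounded_T exp_bounded_T z])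
  also have "laplace (\<lambda>t. pairing (T t ((w - z) *\<^sub>C R x)) y) z
      = laplace (\<lambda>s. (w - z) * laplace (\<lambda>t. pairing (T (s + t) x) y) w) z"
    by (rule laplace_cong)
      (simp add: clinear_scaleC[OF clinear_T] pairing_simps pairing_T_laplace_operator[OF R])
  also have "\<dots> = (w - z) * laplace (\<lambda>s. laplace (\<lambda>t. pairing (T (s + t) x) y) w) z"
    unfolding laplace_def[of _ z] by (simp add: mult.left_commute)
  also have "laplace (\<lambda>t. pairing (T t x) y) z - \<dots> = laplace (\<lambda>t. pairing (T t x) y) w"
    using laplace_laplace_shift[OF exp_bounded_T[of x y] z w] by (simp add: algebra_simps)
  finally show ?thesis
    using R by (simp add: laplace_operator_iff)
qed

end

section \<open>Passing from one point of the half plane to all others\<close>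

text \<open>The step reaches from \<open>u\<close> to the disc of radius
  \<open>(Re u - \<omega>) / M\<close>. Along the segment from \<open>w\<close> to \<open>z\<close>
  these radii are bounded below, so finitely many equal steps suffice.\<close>

lemma halfplane_induct [consumes 3, case_names base step]:
  fixes w z :: complex
  assumes w: "Re w > \<omega>" and z: "Re z > \<omega>" and M: "M > 0"
    and base: "P w"
    and step: "\<And>u v. P u \<Longrightarrow> Re u > \<omega> \<Longrightarrow> Re v > \<omega> \<Longrightarrow> cmod (u - v) * M < Re u - \<omega> \<Longrightarrow> P v"
  shows "P z"
proof -
  define \<delta> where "\<delta> = min (Re w) (Re z) - \<omega>"
  have \<delta>: "\<delta> > 0" using w z by (simp add: \<delta>_def)
  obtain N :: nat where N: "cmod (z - w) * M / \<delta> < real N"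
    using reals_Archimedean2 by blast
  have "0 \<le> cmod (z - w) * M / \<delta>"
    using \<delta> M by simp
  then have N0: "real N > 0" using N by linarith
  define p where "p k = w + complex_of_real (real k / N) * (z - w)" for k
  have Re_p: "Re (p k) - \<omega> \<ge> \<delta>" if "k \<le> N" for k
  proof -
    define r where "r = real k / N"
    have "0 \<le> r" "r \<le> 1" using that N0 by (auto simp: r_def)
    then have "(1 - r) * min (Re w) (Re z) + r * min (Re w) (Re z) \<le> (1 - r) * Re w + r * Re z"
      by (intro add_mono mult_left_mono) auto
    also have "\<dots> = Re (p k)"
      by (simp add: p_def algebra_simps flip: r_def)
    finally show ?thesis by (simp add: \<delta>_def algebra_simps)
  qed
  have "P (p k)" if "k \<le> N" for k
    using that
  proof (induction k)
    case 0
    then show ?case using base by (simp add: p_def)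
  next
    case (Suc k)
    have "p k - p (Suc k) = complex_of_real (1 / N) * (w - z)"
      by (simp add: p_def add_divide_distrib diff_divide_distrib algebra_simps)
    then have "cmod (p k - p (Suc k)) * M = cmod (z - w) * M / N"
      by (simp add: norm_mult norm_divide norm_minus_commute)
    also have "\<dots> < \<delta>"
      using N \<delta> N0 by (simp add: field_simps)
    finally have lt: "cmod (p k - p (Suc k)) * M < \<delta>" .
    show ?case
    proof (rule step)
      show "P (p k)" using Suc by simp
      show "Re (p k) > \<omega>" "Re (p (Suc k)) > \<omega>" "cmod (p k - p (Suc k)) * M < Re (p k) - \<omega>"
        using Re_p[of k] Re_p[of "Suc k"] Suc.prems \<delta> lt by linarith+
    qed
  qed
  from this[of N] show ?thesis
    using N0 by (simp add: p_def)
qed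

text \<open>The induction carries one operator serving both semigroups. In each step the new
  operator is the Neumann series built from the shared \<open>R\<close> alone, so it cannot
  distinguish \<open>T\<close> from \<open>S\<close>.\<close>

lemma laplace_operator_common:
  assumes "measurable_semigroup pairing M \<omega> T" "measurable_semigroup pairing M \<omega> S"
    and "Re w > \<omega>" "Re z > \<omega>"
    and "laplace_operator pairing T w R" "laplace_operator pairing S w R"
  shows "\<exists>Q. laplace_operator pairing T z Q \<and> laplace_operator pairing S z Q"
proof -
  interpret T: measurable_semigroup pairing M \<omega> T by fact
  interpret S: measurable_semigroup pairing M \<omega> S by fact
  have "M > 0" using T.M_ge_1 by simp
  with assms(3,4) show ?thesis
  proof (induction rule: halfplane_induct)
    case base
    then show ?case using assms(5,6) by blast
  next
    case (step u v)
    then obtain R where R: "laplace_operator pairing T u R" "laplace_operator pairing S u R" by blast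
    have "cmod (u - v) * (M / (Re u - \<omega>)) < 1" "M / (Re u - \<omega>) \<ge> 0"
      using step \<open>M > 0\<close> by (simp_all add: field_simps)
    then obtain Q where Q: "Q \<in> weakly_continuous_operators pairing"
      "\<And>x. Q (x - (u - v) *\<^sub>C R x) = R x" "surj (\<lambda>x. x - (u - v) *\<^sub>C R x)"
      using T.weakly_continuous_neumann[OF _ T.norm_laplace_operator_le[OF R(1)], of "u - v"] step R(1)
      unfolding T.laplace_operator_iff by blast
    have "pairing (Q x) y = laplace (\<lambda>t. pairing (T t x) y) v"
      "pairing (Q x) y = laplace (\<lambda>t. pairing (S t x) y) v" for x y
    proof -
      \<comment> \<open>The resolvent identity speaks only of vectors of this form; surjectivity
        makes it cover every \<open>x\<close>.\<close>
      obtain x' where x': "x = x' - (u - v) *\<^sub>C R x'"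
        using surjD[OF Q(3)] by blast
      show "pairing (Q x) y = laplace (\<lambda>t. pairing (T t x) y) v"
        using T.resolvent_identity[OF R(1) step(2,3), of x' y] by (simp only: x' Q(2))
      show "pairing (Q x) y = laplace (\<lambda>t. pairing (S t x) y) v"
        using S.resolvent_identity[OF R(2) step(2,3), of x' y] by (simp only: x' Q(2))
    qed
    then show ?case
      using Q(1) unfolding T.laplace_operator_iff by blast
  qed
qed

text \<open>Existence is propagated from the given point by \<open>laplace_operator_common\<close>,
  with \<open>T\<close> in both places; uniqueness then resolves the definite description.\<close>

lemma integrable_semigroup_laplace_transform:
  assumes "norming_dual_pair pairing" "integrable_semigroup pairing M \<omega> T" "Re z > \<omega>"
  shows "laplace_operator pairing T z (laplace_transform pairing T z)"
proof -
  interpret norming_dual_pair pairing by fact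
  interpret T: measurable_semigroup pairing M \<omega> T
    using assms(2) by unfold_locales (auto simp: integrable_semigroup_def)
  obtain w R where "Re w > \<omega>" "laplace_operator pairing T w R"
    using assms(2) by (auto simp: integrable_semigroup_def)
  then obtain Q where "laplace_operator pairing T z Q"
    using laplace_operator_common[OF T.measurable_semigroup_axioms T.measurable_semigroup_axioms _ assms(3)]
    by blast
  then show ?thesis using laplace_transform_eq by simp
qed

lemma integrable_semigroup_imp_measurable_semigroup:
  assumes "norming_dual_pair pairing" and T: "integrable_semigroup pairing M \<omega> T"
    and le: "M \<le> M'" "\<omega> \<le> \<omega>'"
  shows "measurable_semigroup pairing M' \<omega>' T"
proof -
  interpret norming_dual_pair pairing by fact
  have "semigroup_of_type pairing M' \<omega>' T"
    unfolding semigroup_of_type_def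
  proof (intro conjI allI impI)
    fix t :: real and x assume t: "t \<ge> 0"
    have "norm (T t x) \<le> M * exp (\<omega> * t) * norm x"
      using T t by (simp add: integrable_semigroup_def semigroup_of_type_def)
    also have "\<dots> \<le> M' * exp (\<omega>' * t) * norm x"
      using le t T by (intro mult_right_mono mult_mono)
        (auto intro: mult_right_mono simp: integrable_semigroup_def semigroup_of_type_def)
    finally show "norm (T t x) \<le> M' * exp (\<omega>' * t) * norm x" .
  qed (use T le in \<open>auto simp: integrable_semigroup_def semigroup_of_type_def\<close>)
  then show ?thesis
    using T by unfold_locales (auto simp: integrable_semigroup_def)
qed

text \<open>If no such \<open>s\<close> existed, the exceptional null set and its reflection under
  \<open>t - x\<close> would cover \<open>{0..t}\<close>, an interval of positive length.\<close>

lemma AE_halfline_split: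
  fixes P :: "real \<Rightarrow> bool"
  assumes P: "AE t in lebesgue_on {0..}. P t" and t: "t > 0"
  shows "\<exists>s\<in>{0..t}. P s \<and> P (t - s)"
proof (rule ccontr)
  assume none: "\<not> ?thesis"
  have "AE t in lebesgue. t \<in> {0..} \<longrightarrow> P t"
    using P by (subst (asm) AE_restrict_space_iff) simp_all
  then obtain N where N: "N \<in> null_sets lebesgue" "{t. \<not> (t \<in> {0..} \<longrightarrow> P t)} \<subseteq> N"
    by (auto simp: eventually_ae_filter)
  then have neg: "negligible N" by (simp add: negligible_iff_null_sets)
  have "negligible ((\<lambda>x. t - x) ` N)"
    using neg by (rule negligible_differentiable_image_negligible[rotated])
      (auto intro!: derivative_intros)
  with neg have "negligible (N \<union> (\<lambda>x. t - x) ` N)"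
    by (rule negligible_Un)
  moreover have "{0..t} \<subseteq> N \<union> (\<lambda>x. t - x) ` N"
  proof
    fix s assume s: "s \<in> {0..t}"
    then have "\<not> P s \<or> \<not> P (t - s)" using none by blast
    moreover have "r \<in> N" if "r \<ge> 0" "\<not> P r" for r
      using N(2) that by auto
    ultimately have "s \<in> N \<or> t - s \<in> N" using s by auto
    moreover have "s = t - (t - s)" by simp
    ultimately show "s \<in> N \<union> (\<lambda>x. t - x) ` N" by blast
  qed
  ultimately have "negligible {0..t}" by (rule negligible_subset)
  then show False
    using t negligible_interval(1)[of 0 t] by simp
qed

section \<open>Uniqueness of the semigroup\<close>

lemma Domain_subset_range_resolvent:
  assumes "graph_of R = resolvent z A"
  shows "Domain A \<subseteq> range R"
proof
  fix x assume "x \<in> Domain A"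
  then obtain v where "(x, v) \<in> A" by blast
  then have "(z *\<^sub>C x - v, x) \<in> graph_of R"
    using assms by (auto simp: resolvent_def)
  then show "x \<in> range R" by (auto simp: graph_of_def)
qed

text \<open>The vectors with nonzero pairing form a weakly open set that misses \<open>D\<close>,
  hence also its closure.\<close>

lemma (in norming_dual_pair) eq_0_if_weakly_dense:
  assumes dense: "(weak_topology pairing) closure_of D = UNIV" and zero: "\<And>x. x \<in> D \<Longrightarrow> pairing x y = 0"
  shows "pairing x y = 0"
proof -
  define U where "U = {x. pairing x y \<in> - {0}}"
  have "openin (weak_topology pairing) U"
    unfolding U_def by (intro openin_weak_topology_vimage open_Compl) simp
  moreover have "U \<inter> D = {}"
    using zero by (auto simp: U_def)
  ultimately have "U \<inter> (weak_topology pairing) closure_of D = {}"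
    by (simp add: openin_Int_closure_of_eq_empty)
  then have "x \<notin> U" by (simp add: dense)
  then show ?thesis by (simp add: U_def)
qed

theorem theorem5p4:
  fixes pairing :: "'x::complex_banach \<Rightarrow> 'y::complex_banach \<Rightarrow> complex"
    and T S :: "real \<Rightarrow> 'x \<Rightarrow> 'x"
    and M\<^sub>T \<omega>\<^sub>T M\<^sub>S \<omega>\<^sub>S \<mu> :: real
    and A :: "('x \<times> 'x) set"
  assumes "norming_dual_pair pairing"
    and "integrable_semigroup pairing M\<^sub>T \<omega>\<^sub>T T"
    and "integrable_semigroup pairing M\<^sub>S \<omega>\<^sub>S S"
    and "\<mu> > max \<omega>\<^sub>T \<omega>\<^sub>S"
    and "csubspace A"
    and "graph_of (laplace_transform pairing T (complex_of_real \<mu>)) = resolvent (complex_of_real \<mu>) A"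
    and "graph_of (laplace_transform pairing S (complex_of_real \<mu>)) = resolvent (complex_of_real \<mu>) A"
    and "(weak_topology pairing) closure_of (Domain A) = UNIV \<or> countably_separated pairing"
  shows "\<forall>t\<ge>0. T t = S t"
proof -
  define \<omega> where "\<omega> = max \<omega>\<^sub>T \<omega>\<^sub>S"
  define M where "M = max M\<^sub>T M\<^sub>S"
  define R where "R = laplace_transform pairing T (complex_of_real \<mu>)"
  interpret norming_dual_pair pairing by fact
  interpret T: measurable_semigroup pairing M \<omega> T
    by (rule integrable_semigroup_imp_measurable_semigroup[OF assms(1,2)]) (simp_all add: M_def \<omega>_def)
  interpret S: measurable_semigroup pairing M \<omega> S
    by (rule integrable_semigroup_imp_measurable_semigroup[OF assms(1,3)]) (simp_all add: M_def \<omega>_def)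
  have \<mu>: "Re (complex_of_real \<mu>) > \<omega>" using assms(4) by (simp add: \<omega>_def)
  have RT: "laplace_operator pairing T (complex_of_real \<mu>) R"
    unfolding R_def using assms(4) by (intro integrable_semigroup_laplace_transform[OF assms(1,2)]) simp
  \<comment> \<open>Both graphs equal the same resolvent, and a graph determines its
    function.\<close>
  have "laplace_transform pairing S (complex_of_real \<mu>) = R"
    using assms(6,7) by (auto simp: R_def graph_of_def fun_eq_iff)
  then have RS: "laplace_operator pairing S (complex_of_real \<mu>) R"
    using integrable_semigroup_laplace_transform[OF assms(1,3), of "complex_of_real \<mu>"] assms(4) by simp
  define f where "f x y t = pairing (T t x) y - pairing (S t x) y" for x y t
  have f: "exp_bounded \<omega> (f x y)" for x y
    unfolding f_def[abs_def] by (rule exp_bounded_diff[OF T.exp_bounded_T S.exp_bounded_T])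
  have zero: "laplace (f x y) (complex_of_real \<mu> + of_nat n) = 0" for x y and n :: nat
  proof -
    have n: "Re (complex_of_real \<mu> + of_nat n) > \<omega>" using \<mu> by simp
    then obtain Q where "laplace_operator pairing T (complex_of_real \<mu> + of_nat n) Q"
      "laplace_operator pairing S (complex_of_real \<mu> + of_nat n) Q"
      using laplace_operator_common[OF T.measurable_semigroup_axioms S.measurable_semigroup_axioms \<mu> _ RT RS]
      by blast
    then have "laplace (\<lambda>t. pairing (T t x) y) (complex_of_real \<mu> + of_nat n)
        = laplace (\<lambda>t. pairing (S t x) y) (complex_of_real \<mu> + of_nat n)"
      by (simp add: laplace_operator_iff)
    then show ?thesis
      unfolding f_def[abs_def] laplace_diff[OF T.exp_bounded_T S.exp_bounded_T n] by simp
  qed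
  \<comment> \<open>Both sides are the same factor times a tail integral over \<open>{t..}\<close>,
    and the tails agree for every \<open>t\<close>, not just almost every one.\<close>
  have on_range: "pairing (T t (R x)) y = pairing (S t (R x)) y" if t: "t \<ge> 0" for t x y
  proof -
    let ?h = "\<lambda>r. exp (- complex_of_real \<mu> * complex_of_real r)"
    let ?L = "lebesgue_on {t..}"
    have int: "integrable ?L (\<lambda>r. ?h r * pairing (U r x) y)" if "measurable_semigroup pairing M \<omega> U" for U
    proof -
      have "integrable (lebesgue_on {0..}) (\<lambda>r. ?h r * pairing (U r x) y)"
        by (rule exp_bounded_integrable[OF measurable_semigroup.exp_bounded_T[OF that] \<mu>])
      then have "set_integrable lebesgue {0..} (\<lambda>r. ?h r * pairing (U r x) y)"
        by (simp add: set_integrable_def integrable_restrict_space)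
      then have "set_integrable lebesgue {t..} (\<lambda>r. ?h r * pairing (U r x) y)"
        using t by (elim set_integrable_subset) auto
      then show ?thesis
        by (simp add: set_integrable_def integrable_restrict_space)
    qed
    have "(LINT r|?L. ?h r * pairing (T r x) y) - (LINT r|?L. ?h r * pairing (S r x) y)
        = (LINT r|?L. ?h r * f x y r)"
      using int[OF T.measurable_semigroup_axioms] int[OF S.measurable_semigroup_axioms]
      by (simp add: f_def right_diff_distrib)
    also have "\<dots> = 0"
      by (rule laplace_eq_0_imp_tail_eq_0[OF f \<mu> zero t])
    finally show ?thesis
      using laplace_shift[OF t, of "\<lambda>r. pairing (T r x) y"] laplace_shift[OF t, of "\<lambda>r. pairing (S r x) y"]
      by (simp add: T.pairing_T_laplace_operator[OF RT t] S.pairing_T_laplace_operator[OF RS t])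
  qed
  from assms(8) show ?thesis
  proof
    assume dense: "(weak_topology pairing) closure_of (Domain A) = UNIV"
    have D: "Domain A \<subseteq> range R"
      using Domain_subset_range_resolvent[OF assms(6)] by (simp add: R_def)
    show ?thesis
    proof (intro allI impI ext)
      fix t :: real and x assume t: "t \<ge> 0"
      obtain T' S' where T': "\<And>x y. pairing (T t x) y = pairing x (T' y)"
        and S': "\<And>x y. pairing (S t x) y = pairing x (S' y)"
        using T.adjoint_T[OF t] S.adjoint_T[OF t] by blast
      \<comment> \<open>Adjoints turn the comparison at fixed \<open>t\<close> and \<open>y\<close>
        into one functional, to which weak density applies.\<close>
      have "pairing x (T' y - S' y) = 0" for y
        using dense by (rule eq_0_if_weakly_dense)
          (use D on_range[OF t] in \<open>auto simp: pairing_simps simp flip: T' S'\<close>)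
      then show "T t x = S t x"
        by (intro eq_if_pairing_eq) (simp add: T' S' pairing_simps)
    qed
  next
    assume "countably_separated pairing"
    then obtain V W where V: "countable V" "\<And>y. y \<noteq> 0 \<Longrightarrow> \<exists>x\<in>V. pairing x y \<noteq> 0"
      and W: "countable W" "\<And>x. x \<noteq> 0 \<Longrightarrow> \<exists>y\<in>W. pairing x y \<noteq> 0"
      by (auto simp: countably_separated_def)
    have "AE t in lebesgue_on {0..}. \<forall>x\<in>V. \<forall>y\<in>W. f x y t = 0"
      using laplace_eq_0_imp_AE_eq_0[OF f \<mu> zero] V(1) W(1) by (simp add: AE_ball_countable)
    then have "AE t in lebesgue_on {0..}. t \<ge> 0 \<longrightarrow> T t = S t"
    proof eventually_elim
      case (elim t)
      show ?case
      proof (intro impI ext)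
        fix x assume t: "t \<ge> 0"
        obtain T' S' where T': "\<And>x y. pairing (T t x) y = pairing x (T' y)"
          and S': "\<And>x y. pairing (S t x) y = pairing x (S' y)"
          using T.adjoint_T[OF t] S.adjoint_T[OF t] by blast
        \<comment> \<open>Separation is used twice: \<open>W\<close> first gives equality on
          \<open>V\<close>, then \<open>V\<close> forces the adjoints to agree on all
          \<open>y\<close>, hence the operators on all \<open>x\<close>.\<close>
        have "T t v - S t v = 0" if "v \<in> V" for v
          using elim that W(2)[of "T t v - S t v"] by (auto simp: f_def pairing_simps)
        then have "pairing v (T' y - S' y) = 0" if "v \<in> V" for v y
          using that by (simp add: pairing_simps flip: T' S')
        then have "T' y - S' y = 0" for y
          using V(2) by blast
        then show "T t x = S t x"
          by (intro eq_if_pairing_eq) (simp add: T' S')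
      qed
    qed
    note ae = this
    show ?thesis
    proof (intro allI impI)
      fix t :: real assume "t \<ge> 0"
      show "T t = S t"
      proof (cases "t = 0")
        case False
        \<comment> \<open>Splitting \<open>t\<close> into two good times writes \<open>T t\<close>
          as \<open>T s\<close> after \<open>T (t - s)\<close>, and likewise for
          \<open>S\<close>.\<close>
        with \<open>t \<ge> 0\<close> obtain s where s: "0 \<le> s" "s \<le> t" "T s = S s" "T (t - s) = S (t - s)"
          using AE_halfline_split[OF ae, of t] by auto
        have "T t x = S t x" for x
          using T.T_add[of s "t - s" x] S.T_add[of s "t - s" x] s by simp
        then show ?thesis by blast
      qed (simp add: T.T_zero S.T_zero)
    qed
  qed
qed

end
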